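(* Let $x\in\mathrm{Tam}(B_n)$. Then $x\in\mathsf{Pop}_{\mathrm{Tam}(B_n)}(\mathrm{Tam}(B_n))$ if and only if the value $2n$ occurs in $x$ at a position at least $n+1$ and, for every $k$ such that $\mathrm{half}_k(x)$ exists, letting $m_k$ be the length of $\mathrm{half}_k(x)$, we have $\mathrm{red}(\mathrm{half}_k(x))\in\mathsf{Pop}_{\mathrm{Tam}(A_{m_k-1})}(\mathrm{Tam}(A_{m_k-1}))$.
   Context: $B_n$ is the set of permutations $x=x_1\cdots x_{2n}$ of $\{1,\dots,2n\}$ with $x_i+x_{2n+1-i}=2n+1$ for all $i$, ordered by the right weak order ($x\le y$ iff every pair of values $a<b$ with $b$ before $a$ in $x$ also has $b$ before $a$ in $y$). $x\in B_n$ contains a $312^*$ pattern if there are $i<j<k$ with $x_j<x_k<x_i$ and $x_k\ge n+1$; $\mathrm{Tam}(B_n)$ is the lattice of $312^*$-avoiding elements of $B_n$ with the induced order. $\mathrm{Tam}(A_{m-1})$ is the lattice of $312$-avoiding permutations of $\{1,\dots,m\}$ with the order induced from the right weak order. For a finite lattice $M$, $\mathsf{Pop}_M(x)$ is the meet in $M$ of $x$ and all elements of $M$ covered by $x$; $\mathsf{Pop}_M(M)$ is its image. $\mathrm{half}_k(x)$ is the $k$-th (from the left) maximal substring of consecutive entries of $x$ all of which are $\ge n+1$; for a word $w$ of $m$ distinct integers, $\mathrm{red}(w)$ is the permutation of $\{1,\dots,m\}$ order-isomorphic to $w$. *)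

theory Defs
  imports "HOL-Algebra.Lattice" "HOL-Combinatorics.Multiset_Permutations"
begin

text \<open>
  A permutation \<open>x\<^sub>1 \<dots> x\<^sub>m\<close> is the list of its values, so the entry \<open>x\<^sub>i\<close> is \<open>x ! (i - 1)\<close>;
  list indices below are 0-based unless stated otherwise.
\<close>

definition occurs_before :: "'a list \<Rightarrow> 'a \<Rightarrow> 'a \<Rightarrow> bool" where
  "occurs_before x b a \<longleftrightarrow> (\<exists>i j. i < j \<and> j < length x \<and> x ! i = b \<and> x ! j = a)"

definition weak_le :: "nat list \<Rightarrow> nat list \<Rightarrow> bool" where
  "weak_le x y \<longleftrightarrow> (\<forall>a b. a < b \<and> occurs_before x b a \<longrightarrow> occurs_before y b a)"

definition weak_order :: "nat list set \<Rightarrow> nat list gorder" where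
  "weak_order X = \<lparr>carrier = X, eq = (=), le = weak_le\<rparr>"

definition contains_312 :: "nat list \<Rightarrow> bool" where
  "contains_312 x \<longleftrightarrow> (\<exists>i j k. i < j \<and> j < k \<and> k < length x \<and> x ! j < x ! k \<and> x ! k < x ! i)"

definition contains_312_star :: "nat \<Rightarrow> nat list \<Rightarrow> bool" where
  "contains_312_star n x \<longleftrightarrow>
     (\<exists>i j k. i < j \<and> j < k \<and> k < length x \<and> x ! j < x ! k \<and> x ! k < x ! i \<and> n + 1 \<le> x ! k)"

definition B_perms :: "nat \<Rightarrow> nat list set" where
  "B_perms n = {x \<in> permutations_of_set {1..2*n}.
     \<forall>i\<in>{1..2*n}. x ! (i - 1) + x ! (2*n + 1 - i - 1) = 2*n + 1}"

definition Tam_B :: "nat \<Rightarrow> nat list gorder" where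
  "Tam_B n = weak_order {x \<in> B_perms n. \<not> contains_312_star n x}"

text \<open>The index is the Coxeter rank: \<open>Tam_A r\<close> consists of permutations of \<open>r + 1\<close> letters.\<close>

definition Tam_A :: "nat \<Rightarrow> nat list gorder" where
  "Tam_A r = weak_order {x \<in> permutations_of_set {1..r + 1}. \<not> contains_312 x}"

definition covered_by :: "('a, 'b) gorder_scheme \<Rightarrow> 'a \<Rightarrow> 'a \<Rightarrow> bool" where
  "covered_by M y x \<longleftrightarrow>
     y \<in> carrier M \<and> x \<in> carrier M \<and> y \<sqsubset>\<^bsub>M\<^esub> x \<and>
     \<not> (\<exists>z\<in>carrier M. y \<sqsubset>\<^bsub>M\<^esub> z \<and> z \<sqsubset>\<^bsub>M\<^esub> x)"

definition Pop :: "('a, 'b) gorder_scheme \<Rightarrow> 'a \<Rightarrow> 'a" where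
  "Pop M x = \<Sqinter>\<^bsub>M\<^esub> (insert x {y. covered_by M y x})"

text \<open>
  \<open>large_block n x i j\<close>: the positions \<open>i, \<dots>, j - 1\<close> form a nonempty block of consecutive
  positions of \<open>x\<close> whose entries are all at least \<open>n + 1\<close>.
\<close>

definition large_block :: "nat \<Rightarrow> nat list \<Rightarrow> nat \<Rightarrow> nat \<Rightarrow> bool" where
  "large_block n x i j \<longleftrightarrow> i < j \<and> j \<le> length x \<and> (\<forall>l. i \<le> l \<and> l < j \<longrightarrow> n + 1 \<le> x ! l)"

definition maximal_large_block :: "nat \<Rightarrow> nat list \<Rightarrow> nat \<Rightarrow> nat \<Rightarrow> bool" where
  "maximal_large_block n x i j \<longleftrightarrow> large_block n x i j \<and>
     (\<forall>i' j'. large_block n x i' j' \<and> i' \<le> i \<and> j \<le> j' \<longrightarrow> i' = i \<and> j' = j)"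

text \<open>
  \<open>is_half n x k w\<close>: the \<open>k\<close>-th half of \<open>x\<close> (counted from 1) exists and equals \<open>w\<close>.
\<close>

definition is_half :: "nat \<Rightarrow> nat list \<Rightarrow> nat \<Rightarrow> nat list \<Rightarrow> bool" where
  "is_half n x k w \<longleftrightarrow> (\<exists>i j. maximal_large_block n x i j \<and>
     k = card {i'. i' \<le> i \<and> (\<exists>j'. maximal_large_block n x i' j')} \<and>
     w = take (j - i) (drop i x))"

definition red :: "nat list \<Rightarrow> nat list" where
  "red w = map (\<lambda>a. card {b \<in> set w. b \<le> a}) w"

lemma red_order_isomorphic:
  assumes "i < length w" "j < length w"
  shows "red w ! i < red w ! j \<longleftrightarrow> w ! i < w ! j"
proof -
  have mono: "card {b \<in> set w. b \<le> c} \<le> card {b \<in> set w. b \<le> d}" if "c \<le> d" for c d :: nat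
    using that by (intro card_mono) auto
  have strict: "card {b \<in> set w. b \<le> c} < card {b \<in> set w. b \<le> d}"
    if "c < d" "d \<in> set w" for c d :: nat
  proof (intro psubset_card_mono psubsetI)
    show "{b \<in> set w. b \<le> c} \<noteq> {b \<in> set w. b \<le> d}"
    proof
      assume "{b \<in> set w. b \<le> c} = {b \<in> set w. b \<le> d}"
      moreover have "d \<in> {b \<in> set w. b \<le> d}" using that by simp
      ultimately have "d \<in> {b \<in> set w. b \<le> c}" by blast
      then show False using that by simp
    qed
  qed (use that in auto)
  show ?thesis
    using assms mono[of "w ! j" "w ! i"] strict[of "w ! i" "w ! j"]
    by (cases "w ! i < w ! j") (auto simp: red_def)
qed

lemma red_permutation:
  assumes "distinct w"
  shows "red w \<in> permutations_of_set {1..length w}"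
proof -
  have len: "length (red w) = length w"
    by (simp add: red_def)
  have dist: "distinct (red w)"
    unfolding distinct_conv_nth len
  proof (intro allI impI)
    fix i j assume ij: "i < length w" "j < length w" "i \<noteq> j"
    then have "w ! i \<noteq> w ! j"
      using assms by (simp add: nth_eq_iff_index_eq)
    then show "red w ! i \<noteq> red w ! j"
      using red_order_isomorphic[of i w j] red_order_isomorphic[of j w i] ij by linarith
  qed
  have "set (red w) \<subseteq> {1..length w}"
  proof
    fix c assume "c \<in> set (red w)"
    then obtain a where a: "a \<in> set w" "c = card {b \<in> set w. b \<le> a}"
      by (auto simp: red_def)
    have "{b \<in> set w. b \<le> a} \<noteq> {}"
      using a by auto
    then have "0 < c"
      unfolding a(2) by (simp add: card_gt_0_iff)
    moreover have "c \<le> card (set w)"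
      unfolding a(2) by (intro card_mono) auto
    ultimately show "c \<in> {1..length w}"
      using card_length[of w] by simp
  qed
  moreover have "card (set (red w)) = card {1..length w}"
    using distinct_card[OF dist] len by simp
  ultimately have "set (red w) = {1..length w}"
    by (intro card_subset_eq) auto
  then show ?thesis
    using dist by (simp add: permutations_of_set_def)
qed

end

theory Submission
  imports Defs
begin

text \<open>
  Encode a \<open>312\<^sup>*\<close>-avoiding \<open>x\<close> by two functions on the large values \<open>{n+1..2*n}\<close>: a large \<open>c > a\<close>
  precedes \<open>a\<close> iff \<open>c \<le> T a\<close>, and \<open>c\<close> precedes the mirror image \<open>2 * n + 1 - d\<close> of \<open>d\<close> iff
  \<open>c \<le> S d\<close>. Here \<open>T\<close> is a bracket vector as for the type A Tamari lattice, \<open>S\<close> is a self-conjugate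
  partition shape (\<open>c \<le> S d \<longleftrightarrow> d \<le> S c\<close>), the halves of \<open>x\<close> are the level sets of \<open>S\<close>, and \<open>T\<close>
  respects them. The order is pointwise, so pop acts on \<open>T\<close> exactly as in type A, while it removes from
  every corner of \<open>S\<close> the rectangle spanned by the last top-level components of \<open>T\<close> on the two levels.
  Thus the type A condition on each level is necessary, and the box cannot stay full, which gives
  \<open>S (2 * n) < 2 * n\<close>. Conversely, the type A preimages on the levels can be chosen with a
  single top-level component; then the corners are full level rectangles, and adding to \<open>S\<close> every addable
  rectangle of levels produces a preimage.
\<close>

section \<open>Bracket functions\<close>

text \<open>The shape of the removed rectangles is forced by transitivity: \<open>T\<close> must
  respect the rows of \<open>S\<close> and, by conjugation, its columns. A smaller shape over the
  same \<open>T\<close> that keeps a single cell of the rectangle at a corner must therefore keep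
  the whole corner. This is also the obstacle to the converse: over arbitrary type A preimages, pop
  would take back only part of each added rectangle of levels. Joining the components of a level is
  harmless because pop shortens an arc to just before the next arc with the same end, which restores
  the old components. Necessity on the levels rests on the popped shape still being compatible with
  the unpopped bracket function, which therefore restricts to every level of the new shape. The
  condition \<open>S (2 * n) < 2 * n\<close> is enough for the box: rows of full length cannot be
  enlarged, but some other rows become full, and pop then takes cells only from the latter.\<close>

definition bracket :: "nat \<Rightarrow> nat \<Rightarrow> (nat \<Rightarrow> nat) \<Rightarrow> bool" where
  "bracket l u T \<longleftrightarrow> (\<forall>a. l \<le> a \<and> a \<le> u \<longrightarrow>
     a \<le> T a \<and> T a \<le> u \<and> (\<forall>b. a < b \<and> b \<le> T a \<longrightarrow> T b \<le> T a))"

definition next_level :: "(nat \<Rightarrow> nat) \<Rightarrow> nat \<Rightarrow> nat" where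
  "next_level T a = (LEAST b. a < b \<and> T b = T a)"

text \<open>If \<open>T a\<close> is not \<open>a\<close>, the arc from \<open>a\<close> can be
  shortened, with all others fixed, only so far that it no longer reaches the next arc with the same
  end, since that arc would force it up again. This is the largest admissible value below
  \<open>T a\<close>.\<close>

definition pop_bracket :: "(nat \<Rightarrow> nat) \<Rightarrow> nat \<Rightarrow> nat" where
  "pop_bracket T a = (if T a = a then a else next_level T a - 1)"

lemma bracketD:
  assumes "bracket l u T" "l \<le> a" "a \<le> u"
  shows "a \<le> T a" "T a \<le> u" "\<And>b. a < b \<Longrightarrow> b \<le> T a \<Longrightarrow> T b \<le> T a"
  using assms unfolding bracket_def by blast+

lemma bracket_idem:
  assumes "bracket l u T" "l \<le> a" "a \<le> u"
  shows "T (T a) = T a"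
proof -
  note D = bracketD[OF assms]
  have "T a \<le> T (T a)" using bracketD(1)[OF assms(1), of "T a"] D assms by linarith
  moreover have "T (T a) \<le> T a" using D(1) D(3)[of "T a"] by (cases "T a = a") auto
  ultimately show ?thesis by simp
qed

lemma next_level:
  assumes "bracket l u T" "l \<le> a" "a \<le> u" "T a \<noteq> a"
  shows "a < next_level T a" "next_level T a \<le> T a" "T (next_level T a) = T a"
    "\<And>b. a < b \<Longrightarrow> T b = T a \<Longrightarrow> next_level T a \<le> b"
proof -
  have P: "a < T a \<and> T (T a) = T a"
    using bracket_idem[OF assms(1-3)] bracketD(1)[OF assms(1-3)] assms(4) by simp
  show "a < next_level T a" "T (next_level T a) = T a"
    unfolding next_level_def using LeastI[of "\<lambda>b. a < b \<and> T b = T a", OF P] by auto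
  show "\<And>b. a < b \<Longrightarrow> T b = T a \<Longrightarrow> next_level T a \<le> b"
    unfolding next_level_def by (simp add: Least_le)
  then show "next_level T a \<le> T a" using P by blast
qed

lemma pop_bracket_bounds:
  assumes "bracket l u T" "l \<le> a" "a \<le> u"
  shows "a \<le> pop_bracket T a" "pop_bracket T a \<le> T a" "T a \<noteq> a \<Longrightarrow> pop_bracket T a < T a"
  using bracketD(1)[OF assms] next_level(1,2)[OF assms] by (auto simp: pop_bracket_def)

text \<open>An arc that starts strictly between \<open>a\<close> and \<open>next_level T a\<close>
  and reaches the latter has to contain the arc starting there. It then ends at \<open>T a\<close>
  too, against the minimality of \<open>next_level\<close>.\<close>

lemma pop_bracket_closed:
  assumes B: "bracket l u T" "l \<le> a" "a \<le> u" and b: "a < b" "b \<le> pop_bracket T a"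
  shows "T b \<le> pop_bracket T a"
proof (rule ccontr)
  assume gt: "\<not> T b \<le> pop_bracket T a"
  have ne: "T a \<noteq> a" using b by (auto simp: pop_bracket_def)
  note N = next_level[OF B ne]
  have p: "pop_bracket T a = next_level T a - 1" using ne by (simp add: pop_bracket_def)
  have bu: "b < next_level T a" "b \<le> T a" "b \<le> u" "l \<le> b"
    using b p N bracketD(2)[OF B] B(2) by linarith+
  have "T b \<le> T a" using bracketD(3)[OF B b(1) bu(2)] .
  moreover have "T a \<le> T b"
    using bracketD(3)[OF B(1) bu(4) bu(3), of "next_level T a"] N(3) bu gt p by linarith
  ultimately show False using N(4)[OF b(1)] bu(1) by simp
qed

lemma bracket_pop:
  assumes "bracket l u T" shows "bracket l u (pop_bracket T)"
  unfolding bracket_def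
proof (intro allI impI conjI; (elim conjE)?)
  fix a assume a: "l \<le> a" "a \<le> u"
  note P = pop_bracket_bounds[OF assms a]
  show "a \<le> pop_bracket T a" by fact
  show le: "pop_bracket T a \<le> u" using P(2) bracketD(2)[OF assms a] by linarith
  fix b assume b: "a < b" "b \<le> pop_bracket T a"
  have "pop_bracket T b \<le> T b" using pop_bracket_bounds(2)[OF assms, of b] a b le by linarith
  then show "pop_bracket T b \<le> pop_bracket T a" using pop_bracket_closed[OF assms a b] by linarith
qed

lemma bracket_pop_at:
  assumes "bracket l u T" "l \<le> a" "a \<le> u"
  shows "bracket l u (T(a := pop_bracket T a))"
  unfolding bracket_def
proof (intro allI impI conjI; (elim conjE)?)
  fix c assume c: "l \<le> c" "c \<le> u"
  note P = pop_bracket_bounds[OF assms] and D = bracketD[OF assms(1) c]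
  show "c \<le> (T(a := pop_bracket T a)) c" using P D by auto
  show "(T(a := pop_bracket T a)) c \<le> u" using P D bracketD(2)[OF assms] by auto
  fix b assume b: "c < b" "b \<le> (T(a := pop_bracket T a)) c"
  show "(T(a := pop_bracket T a)) b \<le> (T(a := pop_bracket T a)) c"
    using b pop_bracket_closed[OF assms, of b] D(3)[of b] P(2)
    by (auto split: if_splits)
qed

text \<open>At the last position \<open>a\<close> where \<open>T1\<close> is smaller,
  \<open>T1\<close> and \<open>T\<close> still agree at \<open>next_level T a\<close>. If
  \<open>T1 a\<close> reached that position, it would be forced up to \<open>T a\<close>.\<close>

lemma bracket_below_pop_at:
  assumes B: "bracket l u T" and C: "bracket l u T1"
    and le: "\<And>a. l \<le> a \<Longrightarrow> a \<le> u \<Longrightarrow> T1 a \<le> T a"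
    and lt: "l \<le> a0" "a0 \<le> u" "T1 a0 < T a0"
  obtains a where "l \<le> a" "a \<le> u" "T a \<noteq> a" "T1 a \<le> pop_bracket T a"
proof -
  let ?P = "\<lambda>a. l \<le> a \<and> a \<le> u \<and> T1 a < T a"
  have "\<exists>a. ?P a \<and> (\<forall>b. ?P b \<longrightarrow> id b \<le> id a)"
    by (rule ex_has_greatest_nat[of ?P a0 id "Suc u"]) (use lt in auto)
  then obtain a where a: "?P a" and mx: "\<And>b. ?P b \<Longrightarrow> b \<le> a" by auto
  have ne: "T a \<noteq> a" using bracketD(1)[OF C, of a] a by linarith
  note N = next_level[OF B _ _ ne]
  let ?b = "next_level T a"
  have b: "a < ?b" "?b \<le> T a" "T ?b = T a" "?b \<le> u" using N a bracketD(2)[OF B, of a] by auto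
  have "T1 ?b = T ?b" using mx[of ?b] b le[of ?b] a by (meson le_neq_implies_less le_trans less_imp_le not_le)
  then have "\<not> ?b \<le> T1 a" using bracketD(3)[OF C, of a ?b] a b by auto
  then have "T1 a \<le> pop_bracket T a" using ne by (simp add: pop_bracket_def)
  with that a ne show ?thesis by blast
qed

lemma bracket_pop_at_cover:
  assumes B: "bracket l u T" "l \<le> a" "a \<le> u" and C: "bracket l u T1"
    and eq: "\<And>b. l \<le> b \<Longrightarrow> b \<le> u \<Longrightarrow> b \<noteq> a \<Longrightarrow> T1 b = T b"
    and le: "pop_bracket T a \<le> T1 a" "T1 a \<le> T a"
  shows "T1 a = pop_bracket T a \<or> T1 a = T a"
proof (cases "T a = a")
  case True
  then show ?thesis using le bracketD(1)[OF C B(2,3)] by simp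
next
  case False
  note N = next_level[OF B False]
  let ?b = "next_level T a"
  have "T1 ?b = T a" using eq[of ?b] N B bracketD(2)[OF B] by simp
  then have "T1 a = T a" if "?b \<le> T1 a"
    using bracketD(3)[OF C B(2,3), of ?b] N that le by simp
  then show ?thesis using le False N(1) by (fastforce simp: pop_bracket_def)
qed

text \<open>\<open>next_level\<close> searches all natural numbers, while the two functions agree
  only on \<open>{l..u}\<close>. The search does not leave the interval because its answer is at
  most \<open>U a\<close>.\<close>

lemma pop_bracket_cong:
  assumes B: "bracket l u U" "l \<le> a" "a \<le> u" and eq: "\<And>b. l \<le> b \<Longrightarrow> b \<le> u \<Longrightarrow> T b = U b"
  shows "pop_bracket T a = pop_bracket U a"
proof (cases "U a = a")
  case True
  then show ?thesis using eq B by (simp add: pop_bracket_def)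
next
  case False
  note N = next_level[OF B False]
  have Ta: "T a = U a" using eq B by simp
  have "next_level T a = next_level U a"
    unfolding next_level_def[of T]
  proof (rule Least_equality)
    show "a < next_level U a \<and> T (next_level U a) = T a"
      using N eq[of "next_level U a"] Ta bracketD(2)[OF B] B by simp
    fix b assume b: "a < b \<and> T b = T a"
    show "next_level U a \<le> b"
    proof (cases "b \<le> u")
      case True
      then show ?thesis using N(4)[of b] eq[of b] b Ta B by simp
    next
      case False
      then show ?thesis using N(2) bracketD(2)[OF B] by linarith
    qed
  qed
  then show ?thesis using Ta by (simp add: pop_bracket_def)
qed

lemma bracket_cong:
  assumes "bracket l u U" "\<And>b. l \<le> b \<Longrightarrow> b \<le> u \<Longrightarrow> T b = U b"
  shows "bracket l u T"
  using assms unfolding bracket_def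
  by (smt (verit) le_trans less_imp_le)

text \<open>\<open>V l = u\<close> says that there is just one top-level component. Over such a
  function the removable rectangles of a shape are products of entire levels.\<close>

lemma bracket_connected_preimage:
  assumes B: "bracket l u U" and lu: "l \<le> u"
  obtains V where "bracket l u V" "V l = u" "\<And>a. l \<le> a \<Longrightarrow> a \<le> u \<Longrightarrow> pop_bracket V a = pop_bracket U a"
proof -
  \<comment> \<open>For \<open>v\<close> in \<open>{l..u}\<close>: no arc passes over
    \<open>v\<close>, so a top-level component ends there.\<close>
  define closed where "closed v \<longleftrightarrow> (\<forall>a. l \<le> a \<and> a \<le> v \<longrightarrow> U a \<le> v)" for v
  \<comment> \<open>joins the top-level components of \<open>U\<close> into one; popping separates them again\<close>
  define V where "V a = (if closed (U a) then u else U a)" for a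
  note D = bracketD[OF B]
  have UV: "U a \<le> V a" if "l \<le> a" "a \<le> u" for a using D[OF that] by (simp add: V_def)
  have Vu: "V a \<le> u" if "l \<le> a" "a \<le> u" for a using D[OF that] by (simp add: V_def)
  have cl_u: "closed u" using D by (auto simp: closed_def)
  have bV: "bracket l u V"
    unfolding bracket_def
  proof (intro allI impI conjI; (elim conjE)?)
    fix a assume a: "l \<le> a" "a \<le> u"
    show "a \<le> V a" using UV[OF a] D[OF a] by linarith
    show "V a \<le> u" using Vu[OF a] .
    fix b assume b: "a < b" "b \<le> V a"
    show "V b \<le> V a"
    proof (cases "closed (U a)")
      case True
      then show ?thesis using Vu[of b] a b Vu[OF a] by (simp add: V_def)
    next
      case False
      then have Va: "V a = U a" by (simp add: V_def)
      have Ub: "U b \<le> U a" using D(3)[OF a b(1)] b Va by simp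
      have "\<not> closed (U b)"
      proof
        assume c: "closed (U b)"
        have "b \<le> U b" using D(1)[of b] a b Va D(2)[OF a] by simp
        then have "U a \<le> U b" using c a b unfolding closed_def by (meson le_trans less_imp_le)
        with Ub c False show False by simp
      qed
      then show ?thesis using Ub Va by (simp add: V_def)
    qed
  qed
  have "closed (U l)"
    unfolding closed_def using D(3)[of l] lu by (metis le_neq_implies_less order_refl)
  then have Vl: "V l = u" by (simp add: V_def)
  have pop: "pop_bracket V a = pop_bracket U a" if a: "l \<le> a" "a \<le> u" for a
  proof (cases "U a = a")
    case Ua: True
    show ?thesis
    proof (cases "closed a \<and> a < u")
      case False
      then have "V a = a" using Ua a by (auto simp: V_def)
      then show ?thesis using Ua by (simp add: pop_bracket_def)
    next
      case True
      then have Va: "V a = u" using Ua by (simp add: V_def)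
      \<comment> \<open>\<open>Suc a\<close> opens the next top-level component, so its arc is
        raised to \<open>u\<close> as well, and pop cuts the raised arc of \<open>a\<close> back to
        \<open>a\<close>.\<close>
      have "closed (U (Suc a))"
        unfolding closed_def
      proof (intro allI impI, elim conjE)
        fix c assume c: "l \<le> c" "c \<le> U (Suc a)"
        have le: "Suc a \<le> U (Suc a)" using D(1)[of "Suc a"] a True by simp
        show "U c \<le> U (Suc a)"
        proof (cases "c \<le> a")
          case c': True
          then have "U c \<le> a" using True c unfolding closed_def by blast
          then show ?thesis using le by linarith
        next
          case False
          then show ?thesis using D(3)[of "Suc a" c] a True c by (cases "c = Suc a") auto
        qed
      qed
      then have "V (Suc a) = u" by (simp add: V_def)
      then have "next_level V a = Suc a"
        unfolding next_level_def using Va by (intro Least_equality) auto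
      then show ?thesis using Ua Va True by (simp add: pop_bracket_def)
    qed
  next
    case False
    note N = next_level[OF B a False]
    have Vne: "V a \<noteq> a" using UV[OF a] D[OF a] False by simp
    \<comment> \<open>Raising creates no earlier match: a position before
      \<open>next_level U a\<close> with the same raised value would already have the value
      \<open>U a\<close>.\<close>
    have "next_level V a = next_level U a"
      unfolding next_level_def[of V]
    proof (rule Least_equality)
      show "a < next_level U a \<and> V (next_level U a) = V a" using N by (simp add: V_def)
      fix b assume b: "a < b \<and> V b = V a"
      show "next_level U a \<le> b"
      proof (rule ccontr)
        assume "\<not> next_level U a \<le> b"
        then have blt: "b < next_level U a" by simp
        have bU: "b \<le> U a" "b \<le> u" "l \<le> b" using blt N D(2)[OF a] a b by linarith+
        have Ub: "U b \<le> U a" using D(3)[OF a _ bU(1)] b by simp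
        have "U b = U a"
        proof (cases "closed (U b)")
          case True
          have "a \<le> U b" using D(1)[OF bU(3,2)] b by linarith
          then have "U a \<le> U b" using True a unfolding closed_def by blast
          then show ?thesis using Ub by simp
        next
          case nb: False
          show ?thesis
          proof (cases "closed (U a)")
            case True
            then have "U b = u" using b nb by (simp add: V_def)
            then show ?thesis using cl_u nb by simp
          next
            case False
            then show ?thesis using b nb by (simp add: V_def)
          qed
        qed
        then show False using N(4)[of b] b blt by simp
      qed
    qed
    then show ?thesis using False Vne by (simp add: pop_bracket_def)
  qed
  show ?thesis using that bV Vl pop by blast
qed

section \<open>Bracket functions with a self-conjugate shape\<close>

text \<open>The last clause is transitivity: \<open>T a\<close> occurs weakly before
  \<open>a\<close>, and \<open>a\<close> before the mirror image of \<open>d\<close>. The value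
  \<open>S d = n\<close> stands for an empty row.\<close>

definition tamari_pair :: "nat \<Rightarrow> (nat \<Rightarrow> nat) \<Rightarrow> (nat \<Rightarrow> nat) \<Rightarrow> bool" where
  "tamari_pair n T S \<longleftrightarrow> bracket (n + 1) (2 * n) T \<and>
     (\<forall>d\<in>{n+1..2*n}. n \<le> S d \<and> S d \<le> 2 * n) \<and>
     (\<forall>c\<in>{n+1..2*n}. \<forall>d\<in>{n+1..2*n}. c \<le> S d \<longleftrightarrow> d \<le> S c) \<and>
     (\<forall>a\<in>{n+1..2*n}. \<forall>d\<in>{n+1..2*n}. a \<le> S d \<longrightarrow> T a \<le> S d)"

text \<open>If \<open>v\<close> is the last element of a level, this is where the last top-level
  component of that level starts.\<close>

definition first_with_top :: "nat \<Rightarrow> (nat \<Rightarrow> nat) \<Rightarrow> nat \<Rightarrow> nat" where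
  "first_with_top n T v = (LEAST c. n < c \<and> T c = v)"

text \<open>For a nonempty row \<open>d\<close>, self-conjugacy makes \<open>S (S d)\<close> the
  last row as long as \<open>d\<close>. So the test asks whether \<open>d\<close> lies in the last
  component of its level, and the result cuts off the last component of the level ending at column
  \<open>S d\<close>.\<close>

definition pop_shape :: "nat \<Rightarrow> (nat \<Rightarrow> nat) \<Rightarrow> (nat \<Rightarrow> nat) \<Rightarrow> nat \<Rightarrow> nat" where
  "pop_shape n T S d = (if n < S d \<and> first_with_top n T (S (S d)) \<le> d
     then first_with_top n T (S d) - 1 else S d)"

text \<open>Removal at some corners only, selected by row length: \<open>UNIV\<close> gives the full
  pop, a single corner with its transpose gives one covered element.\<close>

definition pop_shape_on :: "nat \<Rightarrow> (nat \<Rightarrow> nat) \<Rightarrow> (nat \<Rightarrow> nat) \<Rightarrow> nat set \<Rightarrow> nat \<Rightarrow> nat" where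
  "pop_shape_on n T S Q d = (if S d \<in> Q then pop_shape n T S d else S d)"

context
  fixes n :: nat and T S :: "nat \<Rightarrow> nat"
  assumes TS: "tamari_pair n T S"
begin

lemma pair_bracket: "bracket (n + 1) (2 * n) T"
  using TS by (simp add: tamari_pair_def)

lemma pair_range: "d \<in> {n+1..2*n} \<Longrightarrow> n \<le> S d" "d \<in> {n+1..2*n} \<Longrightarrow> S d \<le> 2 * n"
  using TS by (auto simp: tamari_pair_def)

lemma pair_sym: "c \<in> {n+1..2*n} \<Longrightarrow> d \<in> {n+1..2*n} \<Longrightarrow> c \<le> S d \<longleftrightarrow> d \<le> S c"
  using TS by (auto simp: tamari_pair_def)

lemma pair_closed: "a \<in> {n+1..2*n} \<Longrightarrow> d \<in> {n+1..2*n} \<Longrightarrow> a \<le> S d \<Longrightarrow> T a \<le> S d"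
  using TS by (auto simp: tamari_pair_def)

lemma pair_antimono:
  assumes "c \<in> {n+1..2*n}" "d \<in> {n+1..2*n}" "c \<le> d"
  shows "S d \<le> S c"
proof (cases "S d = n")
  case True
  then show ?thesis using pair_range(1)[OF assms(1)] by simp
next
  case False
  then have R: "S d \<in> {n+1..2*n}" using pair_range[OF assms(2)] by simp
  then have "d \<le> S (S d)" using pair_sym assms(2) by blast
  then show ?thesis using pair_sym[OF assms(1) R] assms by simp
qed

lemma pair_T_range: "a \<in> {n+1..2*n} \<Longrightarrow> T a \<in> {n+1..2*n}"
  using bracketD(1,2)[OF pair_bracket, of a] by simp

text \<open>For the harder inequality: \<open>a\<close> lies in row \<open>S a\<close>, closure puts
  \<open>T a\<close> into that row, and transposing puts \<open>S a\<close> into row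
  \<open>T a\<close>.\<close>

lemma pair_T_level:
  assumes "a \<in> {n+1..2*n}" shows "S (T a) = S a"
proof (rule antisym)
  note Ta = pair_T_range[OF assms]
  show "S (T a) \<le> S a" using pair_antimono[OF assms Ta] bracketD(1)[OF pair_bracket, of a] assms by simp
  show "S a \<le> S (T a)"
  proof (cases "S a = n")
    case True
    then show ?thesis using pair_range(1)[OF Ta] by simp
  next
    case False
    then have R: "S a \<in> {n+1..2*n}" using pair_range[OF assms] by simp
    then have "a \<le> S (S a)" using pair_sym assms by blast
    then have "T a \<le> S (S a)" using pair_closed assms R by blast
    then show ?thesis using pair_sym[OF Ta R] by simp
  qed
qed

context
  fixes d assumes d: "d \<in> {n+1..2*n}" and pos: "n < S d"
begin

lemma Sd_range: "S d \<in> {n+1..2*n}" using pair_range(2)[OF d] pos by simp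

lemma d_le_SS: "d \<le> S (S d)" using pair_sym[OF d Sd_range] by simp

lemma SSd_range: "S (S d) \<in> {n+1..2*n}"
  using d_le_SS d pair_range(2)[OF Sd_range] by simp

lemma SSS: "S (S (S d)) = S d"
proof (rule antisym)
  show "S (S (S d)) \<le> S d" using pair_antimono[OF d SSd_range d_le_SS] .
  show "S d \<le> S (S (S d))" using pair_sym[OF Sd_range SSd_range] by simp
qed

lemma T_Sd: "T (S d) = S d"
  using pair_closed[OF Sd_range d] bracketD(1)[OF pair_bracket, of "S d"] Sd_range by simp

lemma first_with_top_Sd:
  shows "n < first_with_top n T (S d)" "T (first_with_top n T (S d)) = S d"
    "first_with_top n T (S d) \<le> S d" "first_with_top n T (S d) \<in> {n+1..2*n}"
    "\<And>c. n < c \<Longrightarrow> T c = S d \<Longrightarrow> first_with_top n T (S d) \<le> c"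
proof -
  have P: "n < S d \<and> T (S d) = S d" using pos T_Sd by simp
  show 1: "n < first_with_top n T (S d)" "T (first_with_top n T (S d)) = S d"
    unfolding first_with_top_def using LeastI[of "\<lambda>c. n < c \<and> T c = S d", OF P] by auto
  show 2: "\<And>c. n < c \<Longrightarrow> T c = S d \<Longrightarrow> first_with_top n T (S d) \<le> c"
    unfolding first_with_top_def by (simp add: Least_le)
  then show "first_with_top n T (S d) \<le> S d" using P by blast
  with 1 show "first_with_top n T (S d) \<in> {n+1..2*n}" using Sd_range by simp
qed

lemma level_of_top:
  assumes "first_with_top n T (S d) \<le> c" "c \<le> S d"
  shows "S c = S (S d)"
proof (rule antisym)
  note F = first_with_top_Sd
  have c: "c \<in> {n+1..2*n}" using assms F Sd_range by simp
  show "S (S d) \<le> S c" using pair_antimono[OF c Sd_range assms(2)] .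
  show "S c \<le> S (S d)"
    using pair_antimono[OF F(4) c assms(1)] pair_T_level[OF F(4)] F(2) by simp
qed

end

lemma pop_shape_le: "d \<in> {n+1..2*n} \<Longrightarrow> pop_shape n T S d \<le> S d"
  using first_with_top_Sd(3)[of d] by (auto simp: pop_shape_def)

lemma pop_shape_ge: "d \<in> {n+1..2*n} \<Longrightarrow> n \<le> pop_shape n T S d"
  using first_with_top_Sd(1)[of d] pair_range(1)[of d] by (auto simp: pop_shape_def)

text \<open>In terms of cells, removal requires that both coordinates lie in the last components of
  their levels. Transposition exchanges these two requirements.\<close>

lemma le_pop_shape_on_iff:
  assumes "d \<in> {n+1..2*n}"
  shows "c \<le> pop_shape_on n T S Q d \<longleftrightarrow> c \<le> S d \<and>
    \<not> (S d \<in> Q \<and> n < S d \<and> first_with_top n T (S (S d)) \<le> d \<and> first_with_top n T (S d) \<le> c)"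
  using first_with_top_Sd[of d] assms by (auto simp: pop_shape_on_def pop_shape_def)

text \<open>If the transposed cell is removed, then \<open>S d = S (S c)\<close> and
  \<open>S (S d) = S c\<close>, so the removal test for the cell itself is the same one with its two
  parts swapped.\<close>

lemma pop_shape_on_sym:
  assumes Q: "\<And>v. v \<in> Q \<Longrightarrow> S v \<in> Q" and c: "c \<in> {n+1..2*n}" and d: "d \<in> {n+1..2*n}"
    and le: "c \<le> pop_shape_on n T S Q d"
  shows "d \<le> pop_shape_on n T S Q c"
proof (rule ccontr)
  assume neg: "\<not> ?thesis"
  have "c \<le> S d" using le le_pop_shape_on_iff[OF d] by blast
  then have dc: "d \<le> S c" using pair_sym c d by blast
  then have X: "S c \<in> Q" "n < S c" "first_with_top n T (S (S c)) \<le> c" "first_with_top n T (S c) \<le> d"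
    using neg le_pop_shape_on_iff[OF c] by blast+
  have Sd: "S d = S (S c)" using level_of_top[OF c X(2) X(4) dc] .
  have SSd: "S (S d) = S c" using SSS[OF c X(2)] Sd by simp
  have "S d \<in> Q" using Q X(1) Sd by simp
  moreover have "n < S d" using \<open>c \<le> S d\<close> c by simp
  ultimately show False using le le_pop_shape_on_iff[OF d] X(3,4) Sd SSd by auto
qed

lemma tamari_pair_pop_on:
  assumes Q: "\<And>v. v \<in> Q \<Longrightarrow> S v \<in> Q"
  shows "tamari_pair n T (pop_shape_on n T S Q)"
  unfolding tamari_pair_def
proof (intro conjI ballI impI)
  show "bracket (n + 1) (2 * n) T" by (rule pair_bracket)
  fix d assume d: "d \<in> {n+1..2*n}"
  show "n \<le> pop_shape_on n T S Q d"
    using pop_shape_ge[OF d] pair_range[OF d] by (simp add: pop_shape_on_def)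
  show "pop_shape_on n T S Q d \<le> 2 * n"
    using pop_shape_le[OF d] pair_range[OF d] by (simp add: pop_shape_on_def)
next
  fix c d assume cd: "c \<in> {n+1..2*n}" "d \<in> {n+1..2*n}"
  show "c \<le> pop_shape_on n T S Q d \<longleftrightarrow> d \<le> pop_shape_on n T S Q c"
    using pop_shape_on_sym[OF Q] cd by blast
next
  fix a d assume a: "a \<in> {n+1..2*n}" and d: "d \<in> {n+1..2*n}"
    and le: "a \<le> pop_shape_on n T S Q d"
  have aS: "a \<le> S d" using le le_pop_shape_on_iff[OF d] by blast
  have TaS: "T a \<le> S d" using pair_closed[OF a d aS] .
  \<comment> \<open>If \<open>T a\<close> lies in the removed part of the row, so does
    \<open>a\<close>: an arc entering that part from before would have to end at \<open>S d\<close>,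
    against the minimality of \<open>first_with_top\<close>.\<close>
  have "first_with_top n T (S d) \<le> a"
    if "n < S d" "first_with_top n T (S d) \<le> T a"
  proof (rule ccontr)
    assume "\<not> ?thesis"
    then have "a < first_with_top n T (S d)" by simp
    then have "T (first_with_top n T (S d)) \<le> T a"
      using bracketD(3)[OF pair_bracket, of a] a that(2) by simp
    then have "T a = S d" using first_with_top_Sd(2)[OF d that(1)] TaS by simp
    then show False
      using first_with_top_Sd(5)[OF d that(1), of a] a \<open>a < first_with_top n T (S d)\<close> by simp
  qed
  then show "T a \<le> pop_shape_on n T S Q d"
    using le TaS le_pop_shape_on_iff[OF d] by blast
qed

lemma pop_shape_on_UNIV: "pop_shape_on n T S UNIV = pop_shape n T S"
  by (simp add: pop_shape_on_def fun_eq_iff)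

lemma tamari_pair_pop_shape: "tamari_pair n T (pop_shape n T S)"
  using tamari_pair_pop_on[of UNIV] by (simp add: pop_shape_on_UNIV)

end

lemma tamari_pair_cong:
  assumes "tamari_pair n T S" "\<And>a. a \<in> {n+1..2*n} \<Longrightarrow> T' a = T a" "\<And>a. a \<in> {n+1..2*n} \<Longrightarrow> S' a = S a"
  shows "tamari_pair n T' S'"
  using assms bracket_cong[of "n+1" "2*n" T T'] unfolding tamari_pair_def by auto

lemma tamari_pair_smaller_bracket:
  assumes TS: "tamari_pair n T S" and "bracket (n+1) (2*n) T'" "\<And>a. a \<in> {n+1..2*n} \<Longrightarrow> T' a \<le> T a"
  shows "tamari_pair n T' S"
  using assms pair_closed[OF TS] unfolding tamari_pair_def by (meson le_trans)

text \<open>One surviving cell restores the corner: closure under \<open>T\<close> extends row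
  \<open>e\<close> of \<open>W\<close> to \<open>S e\<close>, transposing puts \<open>e\<close> into
  row \<open>S e\<close>, and closure extends that row to \<open>S (S e)\<close>. Every row with one
  of the two lengths is then complete.\<close>

lemma pop_shape_all_or_nothing:
  assumes TS: "tamari_pair n T S" and W: "tamari_pair n T W"
    and e: "e \<in> {n+1..2*n}" and le: "W e \<le> S e" and gt: "pop_shape n T S e < W e"
    and f: "f \<in> {n+1..2*n}" "S f = S e \<or> S f = S (S e)"
  shows "S f \<le> W f"
proof -
  have X: "n < S e" "first_with_top n T (S (S e)) \<le> e" "first_with_top n T (S e) \<le> W e"
    using gt le by (auto simp: pop_shape_def split: if_splits)
  note Se = Sd_range[OF TS e X(1)] and SSe = SSd_range[OF TS e X(1)]
  have SSpos: "n < S (S e)" using SSe by simp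
  note F = first_with_top_Sd[OF TS e X(1)] and G = first_with_top_Sd[OF TS Se SSpos]
  have "S e \<le> W e" using pair_closed[OF W F(4) e X(3)] F(2) by simp
  then have "e \<le> W (S e)" using pair_sym[OF W Se e] by simp
  then have W2: "S (S e) \<le> W (S e)" using pair_closed[OF W G(4) Se] G(2) X(2) by simp
  have fpos: "n < S f" using f(2) X(1) SSpos by auto
  note fSS = d_le_SS[OF TS f(1) fpos]
  from f(2) show ?thesis
  proof
    assume eq: "S f = S e"
    then have "f \<le> W (S e)" using fSS W2 by simp
    then show ?thesis using pair_sym[OF W f(1) Se] eq by simp
  next
    assume eq: "S f = S (S e)"
    have "S e \<le> W (S (S e))" using pair_sym[OF W SSe Se] W2 by simp
    then have "f \<le> W (S (S e))" using fSS eq SSS[OF TS e X(1)] by simp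
    then show ?thesis using pair_sym[OF W f(1) SSe] eq by simp
  qed
qed

section \<open>Corners as minimal reductions of the shape\<close>

text \<open>A corner and its transpose, named by their row lengths; self-conjugacy forces both to be
  removed together.\<close>

definition corner :: "(nat \<Rightarrow> nat) \<Rightarrow> nat \<Rightarrow> nat set" where
  "corner S d = {S d, S (S d)}"

lemma tamari_pair_corner:
  assumes TS: "tamari_pair n T S" and d: "d \<in> {n+1..2*n}" "n < S d"
  shows "tamari_pair n T (pop_shape_on n T S (corner S d))"
  by (rule tamari_pair_pop_on[OF TS]) (use SSS[OF TS d] in \<open>auto simp: corner_def\<close>)

lemma corner_proper:
  assumes TS: "tamari_pair n T S" and d: "d \<in> {n+1..2*n}" "n < S d"
  obtains e where "e \<in> {n+1..2*n}" "pop_shape_on n T S (corner S d) e < S e"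
proof
  note Sd = Sd_range[OF TS d] and SSd = SSd_range[OF TS d] and E = SSS[OF TS d]
  \<comment> \<open>The last row with the length of row \<open>d\<close> certainly lies in the last
    component of its level, whereas \<open>d\<close> itself may lie in an earlier one.\<close>
  show "S (S d) \<in> {n+1..2*n}" by (rule SSd)
  have p: "n < S (S d)" using SSd by simp
  show "pop_shape_on n T S (corner S d) (S (S d)) < S (S (S d))"
    using first_with_top_Sd[OF TS d] first_with_top_Sd(3)[OF TS Sd p] d(2) E
    by (simp add: pop_shape_on_def pop_shape_def corner_def)
qed

text \<open>If \<open>W\<close> lost a cell in one row of the corner and kept a removable cell in
  another, the kept cell would restore the lost one by
  \<open>pop_shape_all_or_nothing\<close>.\<close>

lemma corner_cover:
  assumes TS: "tamari_pair n T S" and W: "tamari_pair n T W" and d: "d \<in> {n+1..2*n}" "n < S d"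
    and up: "\<And>f. f \<in> {n+1..2*n} \<Longrightarrow> W f \<le> S f"
    and low: "\<And>f. f \<in> {n+1..2*n} \<Longrightarrow> pop_shape_on n T S (corner S d) f \<le> W f"
  shows "(\<forall>f\<in>{n+1..2*n}. W f = pop_shape_on n T S (corner S d) f) \<or> (\<forall>f\<in>{n+1..2*n}. W f = S f)"
proof (rule disjCI)
  assume "\<not> (\<forall>f\<in>{n+1..2*n}. W f = S f)"
  then obtain f where f: "f \<in> {n+1..2*n}" "W f \<noteq> S f" by blast
  then have fQ: "S f \<in> corner S d" "W f < S f"
    using low[OF f(1)] up[OF f(1)] by (auto simp: pop_shape_on_def split: if_splits)
  show "\<forall>e\<in>{n+1..2*n}. W e = pop_shape_on n T S (corner S d) e"
  proof (rule ballI, rule ccontr)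
    fix e assume e: "e \<in> {n+1..2*n}" and ne: "W e \<noteq> pop_shape_on n T S (corner S d) e"
    have eQ: "S e \<in> corner S d" "pop_shape n T S e < W e"
      using low[OF e] up[OF e] ne by (auto simp: pop_shape_on_def split: if_splits)
    have "S f = S e \<or> S f = S (S e)"
      using eQ(1) fQ(1) SSS[OF TS d] by (auto simp: corner_def)
    then show False
      using pop_shape_all_or_nothing[OF TS W e up[OF e] eQ(2) f(1)] fQ(2) by simp
  qed
qed

text \<open>\<open>W\<close> is antitone, so a loss in row \<open>e\<close> persists down to the
  last row of the same length. By \<open>pop_shape_all_or_nothing\<close>, \<open>W\<close> then
  keeps nothing of the rectangle at the corner of \<open>e\<close>.\<close>

lemma corner_below:
  assumes TS: "tamari_pair n T S" and W: "tamari_pair n T W"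
    and up: "\<And>f. f \<in> {n+1..2*n} \<Longrightarrow> W f \<le> S f"
    and e: "e \<in> {n+1..2*n}" "W e < S e"
  obtains d where "d \<in> {n+1..2*n}" "n < S d"
    "\<And>f. f \<in> {n+1..2*n} \<Longrightarrow> W f \<le> pop_shape_on n T S (corner S d) f"
proof
  have pos: "n < S e" using e pair_range(1)[OF W e(1)] by simp
  show "e \<in> {n+1..2*n}" "n < S e" by fact+
  note SSe = SSd_range[OF TS e(1) pos] and E = SSS[OF TS e(1) pos]
  have lt: "W (S (S e)) < S (S (S e))"
    using pair_antimono[OF W e(1) SSe d_le_SS[OF TS e(1) pos]] e(2) E by simp
  fix f assume f: "f \<in> {n+1..2*n}"
  show "W f \<le> pop_shape_on n T S (corner S e) f"
  proof (rule ccontr)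
    assume "\<not> ?thesis"
    then have fQ: "S f \<in> corner S e" "pop_shape n T S f < W f"
      using up[OF f] by (auto simp: pop_shape_on_def split: if_splits)
    have "S (S (S e)) = S f \<or> S (S (S e)) = S (S f)"
      using fQ(1) E by (auto simp: corner_def)
    then show False
      using pop_shape_all_or_nothing[OF TS W f up[OF f] fQ(2) SSe] lt by simp
  qed
qed

text \<open>The shape is popped with respect to the old \<open>T\<close>; lowering \<open>T\<close>
  afterwards only weakens the closure condition on the rows.\<close>

lemma tamari_pair_pop:
  assumes TS: "tamari_pair n T S"
  shows "tamari_pair n (pop_bracket T) (pop_shape n T S)"
  using tamari_pair_smaller_bracket[OF tamari_pair_pop_shape[OF TS] bracket_pop[OF pair_bracket[OF TS]]]
    pop_bracket_bounds(2)[OF pair_bracket[OF TS]] by simp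

text \<open>In a full box the corner cell has both coordinates \<open>2 * n\<close>, and pop removes
  it.\<close>

lemma pop_shape_last:
  assumes TS: "tamari_pair n T S" and n: "1 \<le> n"
  shows "pop_shape n T S (2 * n) < 2 * n"
proof (cases "S (2 * n) = 2 * n")
  case True
  then show ?thesis using first_with_top_Sd[OF TS, of "2*n"] n by (simp add: pop_shape_def)
next
  case False
  then show ?thesis using pair_range(2)[OF TS, of "2*n"] pop_shape_le[OF TS, of "2*n"] n by simp
qed

section \<open>Levels of the shape and the construction of a preimage\<close>

definition level :: "nat \<Rightarrow> (nat \<Rightarrow> nat) \<Rightarrow> nat \<Rightarrow> nat set" where
  "level n S v = {e \<in> {n+1..2*n}. S e = v}"

lemma level_interval:
  assumes TS: "tamari_pair n T S" and c: "c \<in> {n+1..2*n}"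
  shows "level n S (S c) = {Min (level n S (S c))..Max (level n S (S c))}"
proof
  have fin: "finite (level n S (S c))" by (simp add: level_def)
  have ne: "level n S (S c) \<noteq> {}" using c by (auto simp: level_def)
  show "level n S (S c) \<subseteq> {Min (level n S (S c))..Max (level n S (S c))}" using fin by auto
  show "{Min (level n S (S c))..Max (level n S (S c))} \<subseteq> level n S (S c)"
  proof
    fix e assume e: "e \<in> {Min (level n S (S c))..Max (level n S (S c))}"
    have M: "Min (level n S (S c)) \<in> level n S (S c)" "Max (level n S (S c)) \<in> level n S (S c)" using fin ne by auto
    then have R: "e \<in> {n+1..2*n}" using e by (auto simp: level_def)
    then show "e \<in> level n S (S c)"
      using pair_antimono[OF TS, of "Min (level n S (S c))" e] pair_antimono[OF TS, of e "Max (level n S (S c))"] M e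
      by (auto simp: level_def)
  qed
qed

text \<open>Levels are closed under \<open>T\<close> by \<open>pair_T_level\<close>, which supplies
  the new upper bound \<open>u\<close>.\<close>

lemma bracket_level:
  assumes TS: "tamari_pair n T S" and c: "c \<in> {n+1..2*n}" and lv: "level n S (S c) = {l..u}"
  shows "bracket l u T"
proof -
  have R: "a \<in> {n+1..2*n}" if "l \<le> a" "a \<le> u" for a
  proof -
    have "a \<in> level n S (S c)" using lv that by simp
    then show ?thesis by (simp add: level_def)
  qed
  have Tu: "T a \<le> u" if "l \<le> a" "a \<le> u" for a
  proof -
    have "a \<in> level n S (S c)" using lv that by simp
    then have "T a \<in> level n S (S c)" using pair_T_range[OF TS] pair_T_level[OF TS] by (simp add: level_def)
    then show ?thesis using lv by simp
  qed
  show ?thesis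
    unfolding bracket_def
  proof (intro allI impI conjI; (elim conjE)?)
    fix a assume a: "l \<le> a" "a \<le> u"
    then have a': "n + 1 \<le> a" "a \<le> 2 * n" using R[OF a] by simp_all
    note D = bracketD[OF pair_bracket[OF TS] a']
    show "a \<le> T a" by (rule D)
    show "T a \<le> u" by (rule Tu[OF a])
    fix b assume "a < b" "b \<le> T a"
    then show "T b \<le> T a" by (rule D)
  qed
qed

lemma pop_preimage:
  assumes TS: "tamari_pair n T S" and n: "1 \<le> n" and last: "S (2 * n) < 2 * n"
    and lev: "\<And>c l u. c \<in> {n+1..2*n} \<Longrightarrow> level n S (S c) = {l..u} \<Longrightarrow>
      \<exists>U. bracket l u U \<and> (\<forall>a\<in>{l..u}. T a = pop_bracket U a)"
  obtains T0 S0 where "tamari_pair n T0 S0"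
    "\<And>a. a \<in> {n+1..2*n} \<Longrightarrow> T a = pop_bracket T0 a"
    "\<And>d. d \<in> {n+1..2*n} \<Longrightarrow> S d = pop_shape n T0 S0 d"
proof -
  let ?R = "{n+1..2*n}"
  define lo hi where "lo v = Min (level n S v)" and "hi v = Max (level n S v)" for v
  have iv: "level n S (S c) = {lo (S c)..hi (S c)}" if "c \<in> ?R" for c
    using level_interval[OF TS that] by (simp add: lo_def hi_def)
  have mem: "c \<in> level n S (S c)" if "c \<in> ?R" for c using that by (simp add: level_def)
  have lohi: "lo (S c) \<le> c" "c \<le> hi (S c)" "lo (S c) \<in> ?R" "hi (S c) \<in> ?R"
    "S (lo (S c)) = S c" "S (hi (S c)) = S c" if "c \<in> ?R" for c
  proof -
    show 1: "lo (S c) \<le> c" "c \<le> hi (S c)" using mem[OF that] iv[OF that] by auto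
    then have "lo (S c) \<in> level n S (S c)" "hi (S c) \<in> level n S (S c)" using iv[OF that] by auto
    then show "lo (S c) \<in> ?R" "hi (S c) \<in> ?R" "S (lo (S c)) = S c" "S (hi (S c)) = S c"
      by (simp_all add: level_def)
  qed
  note anti = pair_antimono[OF TS] and sym = pair_sym[OF TS]
  have le_hi: "c \<le> hi (S e) \<longleftrightarrow> S e \<le> S c" if "c \<in> ?R" "e \<in> ?R" for c e
  proof
    assume "c \<le> hi (S e)"
    then show "S e \<le> S c" using anti[OF that(1) lohi(4)[OF that(2)]] lohi(6)[OF that(2)] by simp
  next
    assume le: "S e \<le> S c"
    show "c \<le> hi (S e)"
    proof (rule ccontr)
      assume "\<not> c \<le> hi (S e)"
      then have "S c \<le> S e" using anti[OF lohi(4)[OF that(2)] that(1)] lohi(6)[OF that(2)] by simp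
      then have "S c = S e" using le by simp
      then show False using lohi(2)[OF that(1)] \<open>\<not> c \<le> hi (S e)\<close> by simp
    qed
  qed
  have ge_lo: "lo (S e) \<le> c" if "c \<in> ?R" "e \<in> ?R" "S c \<le> S e" for c e
  proof (rule ccontr)
    assume neg: "\<not> lo (S e) \<le> c"
    then have "S e \<le> S c" using anti[OF that(1) lohi(3)[OF that(2)]] lohi(5)[OF that(2)] by simp
    then have "S e = S c" using that by simp
    then show False using lohi(1)[OF that(1)] neg by simp
  qed
  define good where "good v V \<longleftrightarrow> bracket (lo v) (hi v) V \<and> V (lo v) = hi v \<and>
    (\<forall>a\<in>{lo v..hi v}. T a = pop_bracket V a)" for v V
  have exV: "\<exists>V. good (S c) V" if c: "c \<in> ?R" for c
  proof -
    obtain U where U: "bracket (lo (S c)) (hi (S c)) U" "\<forall>a\<in>{lo (S c)..hi (S c)}. T a = pop_bracket U a"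
      using lev[OF c iv[OF c]] by blast
    have "lo (S c) \<le> hi (S c)" using lohi(1,2)[OF c] by simp
    from bracket_connected_preimage[OF U(1) this] obtain V where
      "bracket (lo (S c)) (hi (S c)) V" "V (lo (S c)) = hi (S c)"
      "\<And>a. lo (S c) \<le> a \<Longrightarrow> a \<le> hi (S c) \<Longrightarrow> pop_bracket V a = pop_bracket U a" by blast
    then have "good (S c) V" using U(2) by (simp add: good_def)
    then show ?thesis by blast
  qed
  \<comment> \<open>The choice depends only on the level, so all positions of a level use the same
    function.\<close>
  define V where "V v = (SOME V. good v V)" for v
  have V: "good (S c) (V (S c))" if "c \<in> ?R" for c
    unfolding V_def by (rule someI_ex[OF exV[OF that]])
  define T0 where "T0 a = V (S a) a" for a
  have T0V: "T0 b = V (S c) b" if "c \<in> ?R" "b \<in> {lo (S c)..hi (S c)}" for b c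
  proof -
    have "b \<in> level n S (S c)" using iv[OF that(1)] that(2) by simp
    then show ?thesis by (simp add: T0_def level_def)
  qed
  have VB: "bracket (lo (S c)) (hi (S c)) (V (S c))" "V (S c) (lo (S c)) = hi (S c)"
    "T c = pop_bracket (V (S c)) c" if "c \<in> ?R" for c
    using V[OF that] lohi(1,2)[OF that] by (auto simp: good_def)
  have T0B: "bracket (lo (S c)) (hi (S c)) T0" if "c \<in> ?R" for c
    by (rule bracket_cong[OF VB(1)[OF that]]) (use T0V[OF that] in auto)
  have T0_lo: "T0 (lo (S c)) = hi (S c)" if "c \<in> ?R" for c
    using T0V[OF that, of "lo (S c)"] VB(2)[OF that] lohi(1,2)[OF that] by simp
  have T0_level: "T0 c \<in> ?R" "S (T0 c) = S c" if "c \<in> ?R" for c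
  proof -
    have "T0 c \<in> {lo (S c)..hi (S c)}" using bracketD(1,2)[OF T0B[OF that] lohi(1,2)[OF that]]
        lohi(1)[OF that] by simp
    then have "T0 c \<in> level n S (S c)" using iv[OF that] by simp
    then show "T0 c \<in> ?R" "S (T0 c) = S c" by (simp_all add: level_def)
  qed
  have BT0: "bracket (n+1) (2*n) T0"
    unfolding bracket_def
  proof (intro allI impI conjI; (elim conjE)?)
    fix a assume a: "n + 1 \<le> a" "a \<le> 2 * n"
    then have R: "a \<in> ?R" by simp
    note D = bracketD[OF T0B[OF R] lohi(1,2)[OF R]]
    show "a \<le> T0 a" by (rule D)
    show "T0 a \<le> 2 * n" using T0_level[OF R] by simp
    fix b assume "a < b" "b \<le> T0 a"
    then show "T0 b \<le> T0 a" by (rule D)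
  qed
  \<comment> \<open>the partition of \<open>S\<close> enlarged by all addable rectangles \<open>level \<times> level\<close>\<close>
  define S0 where "S0 d = (if S d < 2 * n then hi (S (S d + 1)) else 2 * n)" for d
  have succR: "S d + 1 \<in> ?R" if "d \<in> ?R" "S d < 2 * n" for d
    using that pair_range(1)[OF TS that(1)] by simp
  \<comment> \<open>\<open>S d + 1\<close> is the first column outside row \<open>d\<close>. The
    criterion sees \<open>c\<close> and \<open>d\<close> only through \<open>S c\<close> and
    \<open>S d\<close>, so \<open>S0\<close> is a union of products of levels.\<close>
  have le_S0: "c \<le> S0 d \<longleftrightarrow> S d = 2 * n \<or> S (S d + 1) \<le> S c" if "c \<in> ?R" "d \<in> ?R" for c d
    using that le_hi[OF that(1) succR[OF that(2)]] pair_range(2)[OF TS that(2)]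
    by (auto simp: S0_def)
  have S0_sym: "d \<le> S0 c" if c: "c \<in> ?R" and d: "d \<in> ?R" and le: "c \<le> S0 d" for c d
  proof (cases "S d = 2 * n \<or> S c = 2 * n")
    case True
    then show ?thesis using le_S0[OF d c] succR[OF c] pair_range(2)[OF TS c]
        pair_range(2)[OF TS, of "S c + 1"] by (cases "S c = 2 * n") auto
  next
    case False
    then have R: "S c + 1 \<in> ?R" "S d + 1 \<in> ?R" and h: "S (S d + 1) \<le> S c"
      using succR[OF c] succR[OF d] pair_range(2)[OF TS c] pair_range(2)[OF TS d] le_S0[OF c d] le
      by auto
    \<comment> \<open>Otherwise the cell with coordinates \<open>S c + 1\<close> and
      \<open>S d + 1\<close> would belong to the shape \<open>S\<close>, which \<open>h\<close>
      excludes.\<close>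
    have "S (S c + 1) \<le> S d"
    proof (rule ccontr)
      assume "\<not> ?thesis"
      then have "S c + 1 \<le> S (S d + 1)" using sym[OF R(2,1)] by simp
      then show False using h by simp
    qed
    then show ?thesis using le_S0[OF d c] by simp
  qed
  have pair0: "tamari_pair n T0 S0"
    unfolding tamari_pair_def
  proof (intro conjI ballI impI)
    show "bracket (n+1) (2*n) T0" by (rule BT0)
    fix d assume d: "d \<in> ?R"
    show "n \<le> S0 d" "S0 d \<le> 2 * n"
      using lohi(4)[OF succR[OF d]] by (auto simp: S0_def)
  next
    fix c d assume "c \<in> ?R" "d \<in> ?R"
    then show "c \<le> S0 d \<longleftrightarrow> d \<le> S0 c" using S0_sym by blast
  next
    fix a d assume "a \<in> ?R" "d \<in> ?R" "a \<le> S0 d"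
    then show "T0 a \<le> S0 d" using le_S0 T0_level by metis
  qed
  \<comment> \<open>Here the single component pays off: the last component of a level starts where
    the level starts.\<close>
  have first: "first_with_top n T0 (hi (S c)) = lo (S c)" if c: "c \<in> ?R" for c
    unfolding first_with_top_def
  proof (rule Least_equality)
    show "n < lo (S c) \<and> T0 (lo (S c)) = hi (S c)" using T0_lo[OF c] lohi(3)[OF c] by simp
    fix e assume e: "n < e \<and> T0 e = hi (S c)"
    show "lo (S c) \<le> e"
    proof (cases "e \<in> ?R")
      case True
      then have "S e = S c" using T0_level[OF True] e lohi(6)[OF c] by simp
      then show ?thesis using lohi(1)[OF True] by simp
    next
      case False
      then show ?thesis using lohi(3)[OF c] e by simp
    qed
  qed
  have popT: "T a = pop_bracket T0 a" if "a \<in> ?R" for a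
    using pop_bracket_cong[OF VB(1)[OF that] lohi(1,2)[OF that], of T0] T0V[OF that] VB(3)[OF that]
    by simp
  have popS: "S d = pop_shape n T0 S0 d" if d: "d \<in> ?R" for d
  proof (cases "S d < 2 * n")
    case False
    then have Sd: "S d = 2 * n" using pair_range(2)[OF TS d] by simp
    have nR: "2 * n \<in> ?R" using n by simp
    \<comment> \<open>Row \<open>d\<close> was full already and must be spared. \<open>?e\<close> is
      the first row that is not full in \<open>S\<close>; its level forms the last component among
      the rows that are full in \<open>S0\<close>, and \<open>d\<close> lies before it.\<close>
    let ?e = "S (2 * n) + 1"
    have e: "?e \<in> ?R" using succR[OF nR last] .
    have "d \<le> S (2 * n)" using sym[OF nR d] Sd by simp
    moreover have "S ?e < S d"
    proof (rule ccontr)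
      assume "\<not> ?thesis"
      then have "2 * n \<le> S ?e" using Sd by simp
      then show False using sym[OF nR e] by simp
    qed
    ultimately have "d < lo (S ?e)"
      using anti[OF lohi(3)[OF e] d] lohi(5)[OF e] by (metis not_le)
    moreover have "S0 d = 2 * n" "S0 (2 * n) = hi (S ?e)" using Sd last by (auto simp: S0_def)
    ultimately show ?thesis using first[OF e] Sd by (simp add: pop_shape_def)
  next
    case True
    let ?e = "S d + 1"
    have e: "?e \<in> ?R" using succR[OF d True] .
    have S0d: "S0 d = hi (S ?e)" using True by (simp add: S0_def)
    have Sed: "S ?e < d" using sym[OF e d] by simp
    \<comment> \<open>Column \<open>S d + 1\<close> opens its level, because column
      \<open>S d\<close>, if there is one, contains row \<open>d\<close> and column
      \<open>S d + 1\<close> does not. So pop cuts row \<open>d\<close> to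
      \<open>lo (S ?e) - 1\<close>, which is \<open>S d\<close>.\<close>
    have lo_e: "lo (S ?e) = ?e"
    proof (rule ccontr)
      assume "lo (S ?e) \<noteq> ?e"
      then have le: "lo (S ?e) \<le> S d" using lohi(1)[OF e] by simp
      then have R: "S d \<in> ?R" using lohi(3)[OF e] True by simp
      have "d \<le> S (S d)" using sym[OF d R] by simp
      moreover have "S (S d) \<le> S ?e" using anti[OF lohi(3)[OF e] R le] lohi(5)[OF e] by simp
      ultimately show False using Sed by simp
    qed
    have lt: "S ?e < 2 * n" using Sed d by simp
    have f: "S ?e + 1 \<in> ?R" using succR[OF e lt] .
    have "S0 (S0 d) = hi (S (S ?e + 1))" using S0d lohi(6)[OF e] lt by (simp add: S0_def)
    then have "first_with_top n T0 (S0 (S0 d)) \<le> d"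
      using first[OF f] lohi(1)[OF f] Sed by simp
    moreover have "n < S0 d" using lohi(4)[OF e] S0d by simp
    ultimately show ?thesis using first[OF e] lo_e S0d by (simp add: pop_shape_def)
  qed
  show ?thesis using that[OF pair0 popT popS] .
qed

section \<open>Permutations and their inversions\<close>

lemma occurs_before_in_set: "occurs_before x b a \<Longrightarrow> b \<in> set x \<and> a \<in> set x"
  by (auto simp: occurs_before_def)

lemma occurs_before_nth:
  assumes "distinct x" "i < length x" "j < length x"
  shows "occurs_before x (x ! i) (x ! j) \<longleftrightarrow> i < j"
  using assms by (fastforce simp: occurs_before_def nth_eq_iff_index_eq)

lemma occurs_before_trans:
  assumes "distinct x" "occurs_before x a b" "occurs_before x b c"
  shows "occurs_before x a c"
proof -
  obtain i j where ij: "i < j" "j < length x" "x ! i = a" "x ! j = b"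
    using assms(2) unfolding occurs_before_def by blast
  obtain j' k where jk: "j' < k" "k < length x" "x ! j' = b" "x ! k = c"
    using assms(3) unfolding occurs_before_def by blast
  have "j = j'" using assms(1) ij jk nth_eq_iff_index_eq[of x j j'] by simp
  then show ?thesis using ij jk unfolding occurs_before_def by (metis less_trans)
qed

lemma occurs_before_asym:
  assumes "distinct x" "occurs_before x a b"
  shows "\<not> occurs_before x b a"
  using assms by (fastforce simp: occurs_before_def nth_eq_iff_index_eq)

lemma occurs_before_total:
  assumes "a \<in> set x" "b \<in> set x" "a \<noteq> b"
  shows "occurs_before x a b \<or> occurs_before x b a"
  using assms unfolding occurs_before_def in_set_conv_nth by (metis linorder_neqE_nat)

lemma card_occurs_before_nth:
  assumes "distinct x" "i < length x"
  shows "card {b. occurs_before x b (x ! i)} = i"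
proof -
  have "{b. occurs_before x b (x ! i)} = (!) x ` {..<i}"
    using assms by (fastforce simp: occurs_before_def nth_eq_iff_index_eq)
  moreover have "inj_on ((!) x) {..<i}"
    using assms by (auto simp: inj_on_def nth_eq_iff_index_eq)
  ultimately show ?thesis by (simp add: card_image)
qed

text \<open>One inclusion suffices because both relations are total and asymmetric. Equal relations
  give equal positions, the position of a value being the number of its predecessors.\<close>

lemma permutation_eqI:
  assumes "x \<in> permutations_of_set A" "y \<in> permutations_of_set A"
    and le: "\<And>a b. occurs_before x b a \<Longrightarrow> occurs_before y b a"
  shows "x = y"
proof -
  have dx: "distinct x" "set x = A" and dy: "distinct y" "set y = A"
    using assms by (auto simp: permutations_of_set_def)
  have iff: "occurs_before x b a \<longleftrightarrow> occurs_before y b a" for a b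
    using le occurs_before_total[of a x b] occurs_before_asym[OF dy(1)] occurs_before_in_set[of y b a] dx dy
    by metis
  have len: "length x = length y" using dx dy distinct_card by metis
  show ?thesis
  proof (rule nth_equalityI[OF len])
    fix i assume i: "i < length x"
    then obtain j where j: "j < length y" "y ! j = x ! i"
      using dx dy by (metis in_set_conv_nth)
    have "i = j"
      using card_occurs_before_nth[OF dx(1) i] card_occurs_before_nth[OF dy(1) j(1)] j iff by simp
    then show "x ! i = y ! i" using j by simp
  qed
qed

lemma weak_le_antisym:
  assumes "x \<in> permutations_of_set A" "y \<in> permutations_of_set A" "weak_le x y" "weak_le y x"
  shows "x = y"
proof (rule permutation_eqI[OF assms(1,2)])
  fix a b assume ob: "occurs_before x b a"
  have dx: "distinct x" "set x = A" and dy: "distinct y" "set y = A"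
    using assms by (auto simp: permutations_of_set_def)
  show "occurs_before y b a"
  proof (cases "a < b")
    case True
    then show ?thesis using assms(3) ob by (auto simp: weak_le_def)
  next
    case False
    have "a \<noteq> b" using occurs_before_asym[OF dx(1) ob] ob by auto
    then have "\<not> occurs_before y a b"
      using False assms(4) occurs_before_asym[OF dx(1) ob] by (auto simp: weak_le_def)
    then show ?thesis using occurs_before_total[of a y b] occurs_before_in_set[OF ob] dx dy \<open>a \<noteq> b\<close> by auto
  qed
qed

text \<open>The number of predecessors increases strictly along \<open>r\<close>, so sorting by it
  realizes the order.\<close>

lemma exists_permutation_of_order:
  fixes r :: "nat \<Rightarrow> nat \<Rightarrow> bool"
  assumes irr: "\<And>a. a \<in> {1..m} \<Longrightarrow> \<not> r a a"
    and trans: "\<And>a b c. a \<in> {1..m} \<Longrightarrow> b \<in> {1..m} \<Longrightarrow> c \<in> {1..m} \<Longrightarrow> r a b \<Longrightarrow> r b c \<Longrightarrow> r a c"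
    and tot: "\<And>a b. a \<in> {1..m} \<Longrightarrow> b \<in> {1..m} \<Longrightarrow> a \<noteq> b \<Longrightarrow> r a b \<or> r b a"
  obtains x where "x \<in> permutations_of_set {1..m}"
    "\<And>a b. a \<in> {1..m} \<Longrightarrow> b \<in> {1..m} \<Longrightarrow> occurs_before x a b \<longleftrightarrow> r a b"
proof
  define pos where "pos v = card {u\<in>{1..m}. r u v}" for v
  have less: "pos a < pos b" if "a \<in> {1..m}" "b \<in> {1..m}" "r a b" for a b
    unfolding pos_def
  proof (rule psubset_card_mono)
    show "{u\<in>{1..m}. r u a} \<subset> {u\<in>{1..m}. r u b}" using that trans irr by blast
  qed simp
  let ?x = "sort_key pos [1..<Suc m]"
  have x: "distinct ?x" "set ?x = {1..m}" by auto
  then show "?x \<in> permutations_of_set {1..m}" by (simp add: permutations_of_set_def)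
  have imp: "r a b" if ob: "occurs_before ?x a b" for a b
  proof -
    obtain i j where ij: "i < j" "j < length ?x" "?x ! i = a" "?x ! j = b"
      using ob unfolding occurs_before_def by blast
    have R: "a \<in> {1..m}" "b \<in> {1..m}" using occurs_before_in_set[OF ob] x(2) by auto
    have "sorted (map pos ?x)" by (rule sorted_sort_key)
    then have "map pos ?x ! i \<le> map pos ?x ! j"
      by (rule sorted_nth_mono) (use ij in auto)
    then have "pos a \<le> pos b" using ij by (simp del: length_sort)
    then have "\<not> r b a" using less[OF R(2,1)] by linarith
    moreover have "a \<noteq> b" using occurs_before_asym[OF x(1) ob] ob by auto
    ultimately show ?thesis using tot[OF R] by blast
  qed
  fix a b assume R: "a \<in> {1..m}" "b \<in> {1..m}"
  show "occurs_before ?x a b \<longleftrightarrow> r a b"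
  proof
    assume r: "r a b"
    then have "a \<noteq> b" using irr R by blast
    then have "occurs_before ?x a b \<or> occurs_before ?x b a"
      using occurs_before_total[of a ?x b] R x(2) by blast
    then show "occurs_before ?x a b" using imp[of b a] trans[OF R(1,2,1) r] irr R by blast
  qed (rule imp)
qed

text \<open>The classical characterization of inversion sets: \<open>tr\<close> and
  \<open>co\<close> say that the set and its complement are transitive.\<close>

lemma exists_permutation_of_inversions:
  fixes I :: "nat \<Rightarrow> nat \<Rightarrow> bool"
  assumes tr: "\<And>a b c. 1 \<le> a \<Longrightarrow> a < b \<Longrightarrow> b < c \<Longrightarrow> c \<le> m \<Longrightarrow> I c b \<Longrightarrow> I b a \<Longrightarrow> I c a"
    and co: "\<And>a b c. 1 \<le> a \<Longrightarrow> a < b \<Longrightarrow> b < c \<Longrightarrow> c \<le> m \<Longrightarrow> I c a \<Longrightarrow> I c b \<or> I b a"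
  obtains x where "x \<in> permutations_of_set {1..m}"
    "\<And>a b. 1 \<le> a \<Longrightarrow> a < b \<Longrightarrow> b \<le> m \<Longrightarrow> occurs_before x b a \<longleftrightarrow> I b a"
proof -
  define r where "r a b \<longleftrightarrow> (b < a \<and> I a b) \<or> (a < b \<and> \<not> I b a)" for a b
  have tot: "r a b \<or> r b a" if "a \<noteq> b" for a b using that by (auto simp: r_def)
  have trans: "r a c" if R: "a \<in> {1..m}" "b \<in> {1..m}" "c \<in> {1..m}" and ab: "r a b" and bc: "r b c" for a b c
  proof -
    have ne: "a \<noteq> c" using ab bc by (auto simp: r_def)
    have R': "1 \<le> a" "1 \<le> b" "1 \<le> c" "a \<le> m" "b \<le> m" "c \<le> m" using R by auto
    consider "a < b" "b < c" | "a < c" "c < b" | "b < a" "a < c" | "b < c" "c < a" | "c < a" "a < b" | "c < b" "b < a"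
      using ab bc ne unfolding r_def by linarith
    then show ?thesis
    proof cases
      case 1 then show ?thesis using co[of a b c] ab bc R' by (auto simp: r_def)
    next
      case 2 then show ?thesis using tr[of a c b] ab bc R' by (auto simp: r_def)
    next
      case 3 then show ?thesis using tr[of b a c] ab bc R' by (auto simp: r_def)
    next
      case 4 then show ?thesis using co[of b c a] ab bc R' by (auto simp: r_def)
    next
      case 5 then show ?thesis using co[of c a b] ab bc R' by (auto simp: r_def)
    next
      case 6 then show ?thesis using tr[of c b a] ab bc R' by (auto simp: r_def)
    qed
  qed
  have irr: "\<not> r a a" for a by (simp add: r_def)
  obtain x where "x \<in> permutations_of_set {1..m}"
    "\<And>a b. a \<in> {1..m} \<Longrightarrow> b \<in> {1..m} \<Longrightarrow> occurs_before x a b \<longleftrightarrow> r a b"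
    by (rule exists_permutation_of_order[of m r, OF irr trans tot]) blast+
  then show ?thesis using that[of x] by (auto simp: r_def)
qed

lemma initial_segment_bound:
  fixes P :: "nat \<Rightarrow> bool"
  assumes "l \<le> u" and down: "\<And>c c'. l < c \<Longrightarrow> c < c' \<Longrightarrow> c' \<le> u \<Longrightarrow> P c' \<Longrightarrow> P c"
  obtains t where "l \<le> t" "t \<le> u" "\<And>c. l < c \<Longrightarrow> c \<le> u \<Longrightarrow> P c \<longleftrightarrow> c \<le> t"
proof
  \<comment> \<open>Inserting \<open>l\<close> provides the bound for an empty segment.\<close>
  let ?X = "insert l {c. l < c \<and> c \<le> u \<and> P c}"
  have fin: "finite ?X" by (rule finite_subset[of _ "{l..u}"]) (use assms in auto)
  show "l \<le> Max ?X" using fin by simp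
  show "Max ?X \<le> u" using fin assms by simp
  fix c assume c: "l < c" "c \<le> u"
  show "P c \<longleftrightarrow> c \<le> Max ?X"
  proof
    assume "P c" then show "c \<le> Max ?X" using fin c by simp
  next
    assume le: "c \<le> Max ?X"
    have "Max ?X \<in> ?X" using fin by (intro Max_in) auto
    then have "l < Max ?X \<and> Max ?X \<le> u \<and> P (Max ?X)" using le c(1) by auto
    then show "P c" using down[of c "Max ?X"] c le by (cases "c = Max ?X") auto
  qed
qed

text \<open>\<open>Y\<close> is a candidate for the elements covered by \<open>x\<close>:
  \<open>cover\<close> shows that its members are covered, \<open>below\<close> that there are no
  others. The infimum is a choice among greatest lower bounds, and \<open>anti\<close> makes
  \<open>p\<close> the only one.\<close>

lemma Pop_weak_order_eqI:
  assumes xX: "x \<in> X" and pX: "p \<in> X"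
    and anti: "\<And>u v. u \<in> X \<Longrightarrow> v \<in> X \<Longrightarrow> weak_le u v \<Longrightarrow> weak_le v u \<Longrightarrow> u = v"
    and Y: "Y \<subseteq> X" "\<And>y. y \<in> Y \<Longrightarrow> weak_le y x" "x \<notin> Y"
    and cover: "\<And>y w. y \<in> Y \<Longrightarrow> w \<in> X \<Longrightarrow> weak_le y w \<Longrightarrow> weak_le w x \<Longrightarrow> w = y \<or> w = x"
    and below: "\<And>z. z \<in> X \<Longrightarrow> weak_le z x \<Longrightarrow> z \<noteq> x \<Longrightarrow> \<exists>y\<in>Y. weak_le z y"
    and p: "weak_le p x" "\<And>y. y \<in> Y \<Longrightarrow> weak_le p y"
      "\<And>z. z \<in> X \<Longrightarrow> weak_le z x \<Longrightarrow> (\<And>y. y \<in> Y \<Longrightarrow> weak_le z y) \<Longrightarrow> weak_le z p"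
  shows "Pop (weak_order X) x = p"
proof -
  let ?M = "weak_order X"
  have M: "carrier ?M = X" "\<And>u v. u \<sqsubseteq>\<^bsub>?M\<^esub> v \<longleftrightarrow> weak_le u v"
    "\<And>u v. u \<sqsubset>\<^bsub>?M\<^esub> v \<longleftrightarrow> weak_le u v \<and> u \<noteq> v"
    by (simp_all add: weak_order_def lless_def)
  have cov: "{y. covered_by ?M y x} = Y"
  proof (intro equalityI subsetI)
    fix y assume "y \<in> {y. covered_by ?M y x}"
    then have y: "y \<in> X" "weak_le y x" "y \<noteq> x"
      "\<And>z. z \<in> X \<Longrightarrow> weak_le y z \<Longrightarrow> y \<noteq> z \<Longrightarrow> weak_le z x \<Longrightarrow> z \<noteq> x \<Longrightarrow> False"
      by (auto simp: covered_by_def M)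
    obtain y' where y': "y' \<in> Y" "weak_le y y'" using below[OF y(1-3)] by blast
    then have "y = y'" using y(4)[of y'] Y by blast
    then show "y \<in> Y" using y' by simp
  next
    fix y assume y: "y \<in> Y"
    then show "y \<in> {y. covered_by ?M y x}" using Y cover[OF y] xX by (auto simp: covered_by_def M)
  qed
  have iff: "greatest ?M g (Lower ?M (insert x Y)) \<longleftrightarrow> g = p" for g
  proof
    have L: "z \<in> Lower ?M (insert x Y) \<longleftrightarrow> z \<in> X \<and> weak_le z x \<and> (\<forall>y\<in>Y. weak_le z y)" for z
      using xX Y(1) by (auto simp: Lower_def M(1,2))
    have pL: "p \<in> Lower ?M (insert x Y)" unfolding L using p(1,2) pX by blast
    have lowp: "weak_le z p" if "z \<in> Lower ?M (insert x Y)" for z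
      using p(3)[of z] that unfolding L by simp
    have LX: "Lower ?M (insert x Y) \<subseteq> X" using L by (intro subsetI) simp
    have G: "greatest ?M g (Lower ?M (insert x Y)) \<longleftrightarrow>
        g \<in> Lower ?M (insert x Y) \<and> (\<forall>z\<in>Lower ?M (insert x Y). weak_le z g)"
      using LX by (simp add: greatest_def M(1,2))
    show "greatest ?M g (Lower ?M (insert x Y)) \<Longrightarrow> g = p"
      unfolding G using anti[OF subsetD[OF LX] pX] pL lowp by simp
    show "g = p \<Longrightarrow> greatest ?M g (Lower ?M (insert x Y))"
      unfolding G using pL lowp by simp
  qed
  show ?thesis unfolding Pop_def inf_def cov iff by simp
qed

section \<open>Type A\<close>

text \<open>In the applications \<open>down\<close> comes from pattern avoidance and makes the
  larger values before \<open>a\<close> an initial segment, with end \<open>T a\<close>;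
  \<open>trans\<close> makes the arcs nest.\<close>

lemma bracket_of_inversions:
  fixes q :: "nat \<Rightarrow> nat \<Rightarrow> bool"
  assumes down: "\<And>a c c'. l \<le> a \<Longrightarrow> a < c \<Longrightarrow> c < c' \<Longrightarrow> c' \<le> u \<Longrightarrow> q c' a \<Longrightarrow> q c a"
    and trans: "\<And>a b c. l \<le> a \<Longrightarrow> a < b \<Longrightarrow> b < c \<Longrightarrow> c \<le> u \<Longrightarrow> q c b \<Longrightarrow> q b a \<Longrightarrow> q c a"
  obtains T where "bracket l u T" "\<And>a c. l \<le> a \<Longrightarrow> a < c \<Longrightarrow> c \<le> u \<Longrightarrow> q c a \<longleftrightarrow> c \<le> T a"
proof -
  have "\<exists>t. l \<le> a \<and> a \<le> u \<longrightarrow> a \<le> t \<and> t \<le> u \<and> (\<forall>c. a < c \<and> c \<le> u \<longrightarrow> (q c a \<longleftrightarrow> c \<le> t))" for a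
  proof (cases "l \<le> a \<and> a \<le> u")
    case True
    then obtain t where "a \<le> t" "t \<le> u" "\<And>c. a < c \<Longrightarrow> c \<le> u \<Longrightarrow> q c a \<longleftrightarrow> c \<le> t"
      using initial_segment_bound[of a u "\<lambda>c. q c a"] down[of a] by blast
    then show ?thesis by blast
  qed blast
  then obtain T where T: "\<And>a. l \<le> a \<and> a \<le> u \<longrightarrow>
      a \<le> T a \<and> T a \<le> u \<and> (\<forall>c. a < c \<and> c \<le> u \<longrightarrow> (q c a \<longleftrightarrow> c \<le> T a))"
    by metis
  have q: "q c a \<longleftrightarrow> c \<le> T a" if "l \<le> a" "a < c" "c \<le> u" for a c
    using T[of a] that by simp
  have "bracket l u T"
    unfolding bracket_def
  proof (intro allI impI conjI; (elim conjE)?)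
    fix a assume a: "l \<le> a" "a \<le> u"
    show Ta: "a \<le> T a" "T a \<le> u" using T[of a] a by auto
    fix b assume b: "a < b" "b \<le> T a"
    show "T b \<le> T a"
    proof (rule ccontr)
      assume gt: "\<not> T b \<le> T a"
      have bu: "l \<le> b" "b \<le> u" "T b \<le> u" using T[of b] a b Ta by auto
      have "q (T b) b" using q[of b "T b"] bu b gt by simp
      moreover have "q b a" using q[of a b] a b bu by simp
      ultimately have "q (T b) a" using trans[of a b "T b"] a b bu gt by simp
      then show False using q[of a "T b"] a b bu gt by simp
    qed
  qed
  then show ?thesis using that q by blast
qed

lemma permutation_pattern:
  assumes "x \<in> permutations_of_set A" "occurs_before x c a" "occurs_before x a b"
  obtains i j k where "i < j" "j < k" "k < length x" "x ! i = c" "x ! j = a" "x ! k = b"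
proof -
  have d: "distinct x" using assms by (simp add: permutations_of_set_def)
  obtain i j where ij: "i < j" "j < length x" "x ! i = c" "x ! j = a"
    using assms(2) unfolding occurs_before_def by blast
  obtain j' k where jk: "j' < k" "k < length x" "x ! j' = a" "x ! k = b"
    using assms(3) unfolding occurs_before_def by blast
  have "j' = j" using d ij jk nth_eq_iff_index_eq[of x j j'] by simp
  then show ?thesis using that[of i j k] ij jk by simp
qed

text \<open>The offset \<open>s\<close> allows a permutation of \<open>{1..m}\<close> to be encoded by a bracket function on
  the values \<open>{s+1..s+m}\<close> of the half it was obtained from.\<close>

definition encodes_A :: "nat \<Rightarrow> nat \<Rightarrow> nat list \<Rightarrow> (nat \<Rightarrow> nat) \<Rightarrow> bool" where
  "encodes_A s m w T \<longleftrightarrow> (\<forall>a c. 1 \<le> a \<and> a < c \<and> c \<le> m \<longrightarrow>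
     (occurs_before w c a \<longleftrightarrow> c + s \<le> T (a + s)))"

definition avoiders_A :: "nat \<Rightarrow> nat list set" where
  "avoiders_A m = {x \<in> permutations_of_set {1..m}. \<not> contains_312 x}"

lemma avoiders_A_encoded:
  assumes w: "w \<in> avoiders_A m"
  obtains T where "bracket (s+1) (s+m) T" "encodes_A s m w T"
proof -
  have wp: "w \<in> permutations_of_set {1..m}" and av: "\<not> contains_312 w"
    using w by (auto simp: avoiders_A_def)
  then have dw: "distinct w" "set w = {1..m}" by (auto simp: permutations_of_set_def)
  have down: "occurs_before w (c - s) (a - s)"
    if c: "s + 1 \<le> a" "a < c" "c < c'" "c' \<le> s + m" and ob: "occurs_before w (c' - s) (a - s)" for a c c'
  proof (rule ccontr)
    assume neg: "\<not> ?thesis"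
    have "c - s \<in> set w" "a - s \<in> set w" "a - s \<noteq> c - s" using c dw by auto
    then have "occurs_before w (a - s) (c - s)" using occurs_before_total[of "c - s" w "a - s"] neg by metis
    from permutation_pattern[OF wp ob this] obtain i j k where
      "i < j" "j < k" "k < length w" "w ! i = c' - s" "w ! j = a - s" "w ! k = c - s" by blast
    moreover have "a - s < c - s" "c - s < c' - s" using c by auto
    ultimately have "contains_312 w" unfolding contains_312_def by metis
    then show False using av by simp
  qed
  have trans: "occurs_before w (c - s) (a - s)"
    if "occurs_before w (c - s) (b - s)" "occurs_before w (b - s) (a - s)" for a b c
    using occurs_before_trans[OF dw(1)] that by blast
  obtain T where T: "bracket (s+1) (s+m) T"
    "\<And>a c. s+1 \<le> a \<Longrightarrow> a < c \<Longrightarrow> c \<le> s+m \<Longrightarrow> occurs_before w (c - s) (a - s) \<longleftrightarrow> c \<le> T a"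
    by (rule bracket_of_inversions[of "s+1" "s+m" "\<lambda>c a. occurs_before w (c - s) (a - s)"])
      (use down trans in blast)+
  have "encodes_A s m w T" unfolding encodes_A_def using T(2)[of "_ + s" "_ + s"] by auto
  then show ?thesis using that T(1) by blast
qed

lemma encoded_avoids_312:
  assumes w: "w \<in> permutations_of_set {1..m}" and T: "bracket (s+1) (s+m) T" "encodes_A s m w T"
  shows "w \<in> avoiders_A m"
proof -
  have dw: "distinct w" "set w = {1..m}" using w by (auto simp: permutations_of_set_def)
  have "\<not> contains_312 w"
  proof
    assume "contains_312 w"
    then obtain i j k where ijk: "i < j" "j < k" "k < length w" "w ! j < w ! k" "w ! k < w ! i"
      unfolding contains_312_def by blast
    have R: "w ! j \<in> {1..m}" "w ! i \<in> {1..m}" using ijk nth_mem[of j w] nth_mem[of i w] dw by auto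
    have "occurs_before w (w ! i) (w ! j)" using occurs_before_nth[OF dw(1), of i j] ijk by simp
    then have "w ! i + s \<le> T (w ! j + s)" using T(2) R ijk unfolding encodes_A_def by auto
    then have "w ! k + s \<le> T (w ! j + s)" using ijk by simp
    then have "occurs_before w (w ! k) (w ! j)" using T(2) R ijk unfolding encodes_A_def by auto
    then show False using occurs_before_nth[OF dw(1), of k j] ijk by simp
  qed
  then show ?thesis using w by (simp add: avoiders_A_def)
qed

lemma exists_encoded_A:
  assumes T: "bracket (s+1) (s+m) T"
  obtains w where "w \<in> avoiders_A m" "encodes_A s m w T"
proof -
  have tr: "c + s \<le> T (a + s)"
    if "1 \<le> a" "a < b" "b < c" "c \<le> m" "c + s \<le> T (b + s)" "b + s \<le> T (a + s)" for a b c
    using bracketD(3)[OF T, of "a + s" "b + s"] that by simp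
  have co: "c + s \<le> T (b + s) \<or> b + s \<le> T (a + s)" if "b < c" "c + s \<le> T (a + s)" for a b c
    using that by simp
  obtain w where w: "w \<in> permutations_of_set {1..m}"
    "\<And>a b. 1 \<le> a \<Longrightarrow> a < b \<Longrightarrow> b \<le> m \<Longrightarrow> occurs_before w b a \<longleftrightarrow> b + s \<le> T (a + s)"
    by (rule exists_permutation_of_inversions[of m "\<lambda>c a. c + s \<le> T (a + s)"]) (use tr co in blast)+
  then have "encodes_A s m w T" by (simp add: encodes_A_def)
  then show ?thesis using that encoded_avoids_312[OF w(1) T] by blast
qed

text \<open>From left to right it is enough to test the longest inversion at each \<open>a\<close>,
  that of \<open>T a\<close> and \<open>a\<close>.\<close>

lemma weak_le_encodes_A:
  assumes x: "x \<in> avoiders_A m" and X: "bracket (s+1) (s+m) T" "encodes_A s m x T"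
    and Y: "bracket (s+1) (s+m) U" "encodes_A s m y U"
  shows "weak_le x y \<longleftrightarrow> (\<forall>a\<in>{s+1..s+m}. T a \<le> U a)"
proof
  assume le: "weak_le x y"
  show "\<forall>a\<in>{s+1..s+m}. T a \<le> U a"
  proof
    fix a assume a: "a \<in> {s+1..s+m}"
    then have a': "s + 1 \<le> a" "a \<le> s + m" by auto
    note D = bracketD[OF X(1) a'] and E = bracketD[OF Y(1) a']
    show "T a \<le> U a"
    proof (cases "T a = a")
      case False
      have r: "1 \<le> a - s" "a - s < T a - s" "T a - s \<le> m" "T a - s + s = T a" "a - s + s = a"
        using False a' D(1,2) by auto
      have "occurs_before x (T a - s) (a - s)" using X(2) r unfolding encodes_A_def by auto
      then have "occurs_before y (T a - s) (a - s)" using le r unfolding weak_le_def by blast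
      then show ?thesis using Y(2) r unfolding encodes_A_def by auto
    qed (use E in simp)
  qed
next
  assume le: "\<forall>a\<in>{s+1..s+m}. T a \<le> U a"
  show "weak_le x y"
    unfolding weak_le_def
  proof (intro allI impI, elim conjE)
    fix a b assume ab: "a < b" "occurs_before x b a"
    then have R: "1 \<le> a" "b \<le> m" using x occurs_before_in_set[OF ab(2)]
      by (auto simp: avoiders_A_def permutations_of_set_def)
    then have "b + s \<le> T (a + s)" using X(2) ab unfolding encodes_A_def by blast
    also have "\<dots> \<le> U (a + s)" using le R ab by simp
    finally show "occurs_before y b a" using Y(2) ab R unfolding encodes_A_def by blast
  qed
qed

lemma avoiders_A_antisym:
  "x \<in> avoiders_A m \<Longrightarrow> y \<in> avoiders_A m \<Longrightarrow> weak_le x y \<Longrightarrow> weak_le y x \<Longrightarrow> x = y"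
  using weak_le_antisym by (auto simp: avoiders_A_def)

text \<open>Each nontrivial arc yields one covered element, in which this arc alone is shortened.
  The order is pointwise, so the meet shortens all arcs at once.\<close>

lemma Pop_A_encoded:
  assumes x: "x \<in> avoiders_A m" and T: "bracket (s+1) (s+m) T" "encodes_A s m x T"
    and p: "p \<in> avoiders_A m" "encodes_A s m p (pop_bracket T)"
  shows "Pop (weak_order (avoiders_A m)) x = p"
proof (rule Pop_weak_order_eqI[where Y = "{y \<in> avoiders_A m.
      \<exists>a\<in>{s+1..s+m}. T a \<noteq> a \<and> encodes_A s m y (T(a := pop_bracket T a))}"])
  let ?Y = "{y \<in> avoiders_A m. \<exists>a\<in>{s+1..s+m}. T a \<noteq> a \<and> encodes_A s m y (T(a := pop_bracket T a))}"
  have B: "bracket (s+1) (s+m) (T(a := pop_bracket T a))" if "a \<in> {s+1..s+m}" for a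
    using bracket_pop_at[OF T(1)] that by simp
  note Bp = bracket_pop[OF T(1)]
  note bnd = pop_bracket_bounds[OF T(1)]
  show "x \<in> avoiders_A m" "p \<in> avoiders_A m" by fact+
  show "u = v" if "u \<in> avoiders_A m" "v \<in> avoiders_A m" "weak_le u v" "weak_le v u" for u v
    using avoiders_A_antisym that by blast
  show "?Y \<subseteq> avoiders_A m" by blast
  have le_x: "weak_le y x \<longleftrightarrow> (\<forall>a\<in>{s+1..s+m}. U a \<le> T a)"
    and x_le: "weak_le x y \<longleftrightarrow> (\<forall>a\<in>{s+1..s+m}. T a \<le> U a)"
    if "y \<in> avoiders_A m" "bracket (s+1) (s+m) U" "encodes_A s m y U" for y U
    using weak_le_encodes_A that x T by blast+
  show "weak_le y x" if "y \<in> ?Y" for y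
    using that le_x[OF _ B] bnd(2) by auto
  show "x \<notin> ?Y"
  proof
    assume "x \<in> ?Y"
    then obtain a where a: "a \<in> {s+1..s+m}" "T a \<noteq> a" "encodes_A s m x (T(a := pop_bracket T a))" by blast
    have "weak_le x x" by (simp add: weak_le_def)
    then show False using x_le[OF x B[OF a(1)] a(3)] a bnd(3)[of a] by fastforce
  qed
  show "w = y \<or> w = x" if y: "y \<in> ?Y" and w: "w \<in> avoiders_A m" and le: "weak_le y w" "weak_le w x" for y w
  proof -
    obtain a where a: "y \<in> avoiders_A m" "a \<in> {s+1..s+m}" "T a \<noteq> a"
      "encodes_A s m y (T(a := pop_bracket T a))" using y by blast
    obtain U where U: "bracket (s+1) (s+m) U" "encodes_A s m w U" using avoiders_A_encoded[OF w] by blast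
    have up: "\<forall>b\<in>{s+1..s+m}. U b \<le> T b" using le_x[OF w U] le(2) by blast
    have low: "\<forall>b\<in>{s+1..s+m}. (T(a := pop_bracket T a)) b \<le> U b"
      using weak_le_encodes_A[OF a(1) B[OF a(2)] a(4) U] le(1) by blast
    have eq: "U b = T b" if "b \<in> {s+1..s+m}" "b \<noteq> a" for b
      using up low that by (metis fun_upd_other le_antisym)
    have a': "s + 1 \<le> a" "a \<le> s + m" using a(2) by auto
    have "pop_bracket T a \<le> U a" using bspec[OF low a(2)] by simp
    moreover have "U a \<le> T a" using bspec[OF up a(2)] .
    moreover have "U b = T b" if "s + 1 \<le> b" "b \<le> s + m" "b \<noteq> a" for b using eq that by simp
    ultimately have "U a = pop_bracket T a \<or> U a = T a"
      using bracket_pop_at_cover[OF T(1) a' U(1)] by blast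
    then show ?thesis
    proof
      assume "U a = pop_bracket T a"
      then have "weak_le w y"
        using weak_le_encodes_A[OF w U B[OF a(2)] a(4)] eq by simp
      then show ?thesis using avoiders_A_antisym[OF w a(1)] le by blast
    next
      assume "U a = T a"
      then have "\<forall>b\<in>{s+1..s+m}. T b \<le> U b" using eq by (metis order_refl)
      then have "weak_le x w" using x_le[OF w U] by blast
      then show ?thesis using avoiders_A_antisym[OF w x] le by blast
    qed
  qed
  show "\<exists>y\<in>?Y. weak_le z y" if z: "z \<in> avoiders_A m" "weak_le z x" "z \<noteq> x" for z
  proof -
    obtain U where U: "bracket (s+1) (s+m) U" "encodes_A s m z U" using avoiders_A_encoded[OF z(1)] by blast
    have up: "\<And>b. s+1 \<le> b \<Longrightarrow> b \<le> s+m \<Longrightarrow> U b \<le> T b" using le_x[OF z(1) U] z(2) by auto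
    have "\<not> weak_le x z" using avoiders_A_antisym[OF z(1) x] z by blast
    then obtain a0 where a0: "s+1 \<le> a0" "a0 \<le> s+m" "U a0 < T a0"
      using x_le[OF z(1) U] by (meson atLeastAtMost_iff not_le)
    obtain a where a: "s+1 \<le> a" "a \<le> s+m" "T a \<noteq> a" "U a \<le> pop_bracket T a"
      using bracket_below_pop_at[OF T(1) U(1) up a0] by blast
    obtain y where y: "y \<in> avoiders_A m" "encodes_A s m y (T(a := pop_bracket T a))"
      using exists_encoded_A[OF B] a by (metis atLeastAtMost_iff)
    have "weak_le z y"
      using weak_le_encodes_A[OF z(1) U B y(2)] a up by simp
    moreover have "y \<in> ?Y" using y a(3) atLeastAtMost_iff a(1,2) by blast
    ultimately show ?thesis by blast
  qed
  show "weak_le p x" using le_x[OF p(1) Bp p(2)] bnd(2) by simp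
  show "weak_le p y" if "y \<in> ?Y" for y
    using that weak_le_encodes_A[OF p(1) Bp p(2) B] bnd(2) by auto
  show "weak_le z p" if z: "z \<in> avoiders_A m" "weak_le z x" "\<And>y. y \<in> ?Y \<Longrightarrow> weak_le z y" for z
  proof -
    obtain U where U: "bracket (s+1) (s+m) U" "encodes_A s m z U" using avoiders_A_encoded[OF z(1)] by blast
    have "U a \<le> pop_bracket T a" if a: "a \<in> {s+1..s+m}" for a
    proof (cases "T a = a")
      case True
      have "U a \<le> T a" using le_x[OF z(1) U] z(2) a by blast
      then show ?thesis using True by (simp add: pop_bracket_def)
    next
      case False
      obtain y where y: "y \<in> avoiders_A m" "encodes_A s m y (T(a := pop_bracket T a))"
        using exists_encoded_A[OF B[OF a]] by blast
      then have "weak_le z y" using z(3)[of y] a False by blast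
      then have "U a \<le> (T(a := pop_bracket T a)) a"
        using weak_le_encodes_A[OF z(1) U B[OF a] y(2)] a by blast
      then show ?thesis by simp
    qed
    then show ?thesis using weak_le_encodes_A[OF z(1) U Bp p(2)] by blast
  qed
qed

lemma Pop_A_image_iff:
  assumes w: "w \<in> permutations_of_set {1..m}" and T: "bracket (s+1) (s+m) T" "encodes_A s m w T"
  shows "w \<in> Pop (weak_order (avoiders_A m)) ` avoiders_A m \<longleftrightarrow>
    (\<exists>U. bracket (s+1) (s+m) U \<and> (\<forall>a\<in>{s+1..s+m}. T a = pop_bracket U a))"
proof
  note wX = encoded_avoids_312[OF w T]
  assume "w \<in> Pop (weak_order (avoiders_A m)) ` avoiders_A m"
  then obtain v where v: "v \<in> avoiders_A m" "w = Pop (weak_order (avoiders_A m)) v" by blast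
  obtain U where U: "bracket (s+1) (s+m) U" "encodes_A s m v U" using avoiders_A_encoded[OF v(1)] by blast
  obtain p where p: "p \<in> avoiders_A m" "encodes_A s m p (pop_bracket U)"
    using exists_encoded_A[OF bracket_pop[OF U(1)]] by blast
  have "w = p" using Pop_A_encoded[OF v(1) U p] v(2) by simp
  \<comment> \<open>Comparing \<open>w\<close> with itself under its two encodings shows that they
    agree on the range.\<close>
  moreover have "weak_le w w" by (simp add: weak_le_def)
  ultimately have "\<forall>a\<in>{s+1..s+m}. T a = pop_bracket U a"
    using weak_le_encodes_A[OF wX T bracket_pop[OF U(1)] p(2)]
      weak_le_encodes_A[OF p(1) bracket_pop[OF U(1)] p(2) T] by (auto intro: antisym)
  then show "\<exists>U. bracket (s+1) (s+m) U \<and> (\<forall>a\<in>{s+1..s+m}. T a = pop_bracket U a)"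
    using U(1) by blast
next
  note wX = encoded_avoids_312[OF w T]
  assume "\<exists>U. bracket (s+1) (s+m) U \<and> (\<forall>a\<in>{s+1..s+m}. T a = pop_bracket U a)"
  then obtain U where U: "bracket (s+1) (s+m) U" "\<forall>a\<in>{s+1..s+m}. T a = pop_bracket U a" by blast
  obtain v where v: "v \<in> avoiders_A m" "encodes_A s m v U" using exists_encoded_A[OF U(1)] by blast
  have "encodes_A s m w (pop_bracket U)" using T(2) U(2) by (auto simp: encodes_A_def)
  then have "Pop (weak_order (avoiders_A m)) v = w" using Pop_A_encoded[OF v(1) U(1) v(2) wX] by blast
  then show "w \<in> Pop (weak_order (avoiders_A m)) ` avoiders_A m" using v(1) by blast
qed

section \<open>Type B\<close>

text \<open>The value \<open>2 * n + 1 - d\<close> is the negative of \<open>d\<close> in the signed notation for \<open>B\<^sub>n\<close>;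
  inversions between two small values are determined by the symmetry.\<close>

definition encodes_B :: "nat \<Rightarrow> nat list \<Rightarrow> (nat \<Rightarrow> nat) \<Rightarrow> (nat \<Rightarrow> nat) \<Rightarrow> bool" where
  "encodes_B n x T S \<longleftrightarrow>
     (\<forall>a c. n + 1 \<le> a \<and> a < c \<and> c \<le> 2 * n \<longrightarrow> (occurs_before x c a \<longleftrightarrow> c \<le> T a)) \<and>
     (\<forall>c\<in>{n+1..2*n}. \<forall>d\<in>{n+1..2*n}. occurs_before x c (2 * n + 1 - d) \<longleftrightarrow> c \<le> S d)"

definition avoiders_B :: "nat \<Rightarrow> nat list set" where
  "avoiders_B n = {x \<in> B_perms n. \<not> contains_312_star n x}"

lemma encodes_BD:
  assumes "encodes_B n x T S"
  shows "\<And>a c. n + 1 \<le> a \<Longrightarrow> a < c \<Longrightarrow> c \<le> 2 * n \<Longrightarrow> occurs_before x c a \<longleftrightarrow> c \<le> T a"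
    "\<And>c d. c \<in> {n+1..2*n} \<Longrightarrow> d \<in> {n+1..2*n} \<Longrightarrow> occurs_before x c (2 * n + 1 - d) \<longleftrightarrow> c \<le> S d"
  using assms unfolding encodes_B_def by blast+

lemma B_perms_permutation: "x \<in> B_perms n \<Longrightarrow> x \<in> permutations_of_set {1..2*n}"
  by (simp add: B_perms_def)

lemma B_perms_list:
  assumes "x \<in> B_perms n"
  shows "distinct x" "set x = {1..2*n}" "length x = 2 * n"
proof -
  show "distinct x" "set x = {1..2*n}" using assms by (auto simp: B_perms_def permutations_of_set_def)
  then show "length x = 2 * n" using distinct_card[of x] by simp
qed

lemma B_perms_nth:
  assumes "x \<in> B_perms n" "i < 2 * n"
  shows "x ! (2 * n - 1 - i) = 2 * n + 1 - x ! i"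
proof -
  have "Suc i \<in> {1..2*n}" using assms by simp
  then have "x ! (Suc i - 1) + x ! (2 * n + 1 - Suc i - 1) = 2 * n + 1"
    using assms(1) unfolding B_perms_def by blast
  moreover have "2 * n + 1 - Suc i - 1 = 2 * n - 1 - i" by simp
  ultimately show ?thesis by simp
qed

lemma occurs_before_mirror:
  assumes x: "x \<in> B_perms n" and ob: "occurs_before x b a"
  shows "occurs_before x (2 * n + 1 - a) (2 * n + 1 - b)"
proof -
  obtain i j where ij: "i < j" "j < length x" "x ! i = b" "x ! j = a"
    using ob unfolding occurs_before_def by blast
  then have "2 * n - 1 - j < 2 * n - 1 - i" "2 * n - 1 - i < length x"
    using B_perms_list(3)[OF x] by auto
  moreover have "x ! (2 * n - 1 - j) = 2 * n + 1 - a" "x ! (2 * n - 1 - i) = 2 * n + 1 - b"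
    using B_perms_nth[OF x] ij B_perms_list(3)[OF x] by auto
  ultimately show ?thesis unfolding occurs_before_def by blast
qed

text \<open>\<open>?y\<close> is \<open>x\<close> reversed with complemented values, and the
  defining equations of \<open>B_perms\<close> amount to \<open>x = ?y\<close>.\<close>

lemma B_perms_of_symmetric_inversions:
  assumes x: "x \<in> permutations_of_set {1..2*n}"
    and sym: "\<And>a b. a < b \<Longrightarrow> occurs_before x b a \<Longrightarrow> occurs_before x (2 * n + 1 - a) (2 * n + 1 - b)"
  shows "x \<in> B_perms n"
proof -
  let ?bar = "\<lambda>v::nat. 2 * n + 1 - v"
  let ?y = "rev (map ?bar x)"
  have dx: "distinct x" "set x = {1..2*n}" using x by (auto simp: permutations_of_set_def)
  then have len: "length x = 2 * n" using distinct_card[of x] by simp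
  have inj: "inj_on ?bar {1..2*n}" by (auto simp: inj_on_def)
  have im: "?bar ` {1..2*n} = {1..2*n}"
  proof
    show "{1..2*n} \<subseteq> ?bar ` {1..2*n}"
    proof
      fix v assume "v \<in> {1..2*n}"
      then have "v = ?bar (?bar v)" "?bar v \<in> {1..2*n}" by auto
      then show "v \<in> ?bar ` {1..2*n}" by blast
    qed
  qed auto
  have y: "?y \<in> permutations_of_set {1..2*n}"
    using dx inj im by (auto simp: permutations_of_set_def distinct_map)
  have ynth: "?y ! i = ?bar (x ! (2 * n - 1 - i))" if "i < 2 * n" for i
    using that len by (simp add: rev_nth)
  have oby: "occurs_before ?y (?bar a) (?bar b)" if "occurs_before x b a" for a b
  proof -
    obtain i j where ij: "i < j" "j < length x" "x ! i = b" "x ! j = a"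
      using \<open>occurs_before x b a\<close> unfolding occurs_before_def by blast
    then have "2 * n - 1 - j < 2 * n - 1 - i" "2 * n - 1 - i < length ?y"
      "?y ! (2 * n - 1 - j) = ?bar a" "?y ! (2 * n - 1 - i) = ?bar b"
      using ynth len by auto
    then show ?thesis unfolding occurs_before_def by blast
  qed
  \<comment> \<open>For a non-inversion: if the mirrored pair were in the wrong order, it would be
    an inversion, and \<open>sym\<close> would mirror it back to contradict
    \<open>ob\<close>.\<close>
  have sym': "occurs_before x (?bar a) (?bar b)" if ob: "occurs_before x b a" for a b
  proof (cases "a < b")
    case True
    then show ?thesis using sym ob by blast
  next
    case False
    have R: "a \<in> {1..2*n}" "b \<in> {1..2*n}" using occurs_before_in_set[OF ob] dx by auto
    have ne: "a \<noteq> b" using occurs_before_asym[OF dx(1) ob] ob by auto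
    show ?thesis
    proof (rule ccontr)
      assume neg: "\<not> ?thesis"
      have "?bar a \<in> set x" "?bar b \<in> set x" "?bar a \<noteq> ?bar b" using R dx ne by auto
      then have "occurs_before x (?bar b) (?bar a)" using occurs_before_total neg by metis
      moreover have "?bar a < ?bar b" using False ne R by auto
      ultimately have "occurs_before x (?bar (?bar a)) (?bar (?bar b))" using sym by blast
      then show False using occurs_before_asym[OF dx(1) ob] R by simp
    qed
  qed
  have "x = ?y"
  proof (rule permutation_eqI[OF x y])
    fix a b assume ob: "occurs_before x b a"
    then have "occurs_before ?y (?bar (?bar b)) (?bar (?bar a))" using oby sym' by blast
    moreover have "a \<in> {1..2*n}" "b \<in> {1..2*n}" using occurs_before_in_set[OF ob] dx by auto
    ultimately show "occurs_before ?y b a" by simp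
  qed
  then have nth: "x ! i = ?bar (x ! (2 * n - 1 - i))" if "i < 2 * n" for i using ynth[OF that] by metis
  have "x ! (i - 1) + x ! (2 * n + 1 - i - 1) = 2 * n + 1" if i: "i \<in> {1..2*n}" for i
  proof -
    have eq: "2 * n - 1 - (i - 1) = 2 * n + 1 - i - 1" using i by auto
    have "2 * n + 1 - i - 1 < length x" using i len by auto
    then have "x ! (2 * n + 1 - i - 1) \<in> {1..2*n}" using dx(2) nth_mem by blast
    then show ?thesis using nth[of "i - 1"] eq i by auto
  qed
  then show ?thesis using x unfolding B_perms_def by blast
qed

lemma avoiders_B_encoded:
  assumes xA: "x \<in> avoiders_B n"
  obtains T S where "tamari_pair n T S" "encodes_B n x T S"
proof -
  let ?R = "{n+1..2*n}"
  let ?bar = "\<lambda>v::nat. 2 * n + 1 - v"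
  have x: "x \<in> B_perms n" and av: "\<not> contains_312_star n x" using xA by (auto simp: avoiders_B_def)
  note xl = B_perms_list[OF x]
  \<comment> \<open>The starred pattern constrains only the middle value \<open>c\<close>. As
    \<open>a\<close> may be small, this serves \<open>T\<close> and \<open>S\<close> alike.\<close>
  have down: "occurs_before x c a" if c: "1 \<le> a" "n + 1 \<le> c" "a < c" "c < c'" "c' \<le> 2 * n" and ob: "occurs_before x c' a" for a c c'
  proof (rule ccontr)
    assume neg: "\<not> ?thesis"
    have "c \<in> set x" "a \<in> set x" "a \<noteq> c" using c xl by auto
    then have "occurs_before x a c" using occurs_before_total neg by metis
    from permutation_pattern[OF B_perms_permutation[OF x] ob this] obtain i j k where
      "i < j" "j < k" "k < length x" "x ! i = c'" "x ! j = a" "x ! k = c" by blast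
    then have "contains_312_star n x" unfolding contains_312_star_def using c by metis
    then show False using av by simp
  qed
  have dl: "occurs_before x c a"
    if "n + 1 \<le> a" "a < c" "c < c'" "c' \<le> 2 * n" "occurs_before x c' a" for a c c'
    using down[of a c c'] that by simp
  have tl: "occurs_before x c a" if "occurs_before x c b" "occurs_before x b a" for a b c
    using occurs_before_trans[OF xl(1) that] .
  obtain T where T: "bracket (n+1) (2*n) T"
    "\<And>a c. n+1 \<le> a \<Longrightarrow> a < c \<Longrightarrow> c \<le> 2*n \<Longrightarrow> occurs_before x c a \<longleftrightarrow> c \<le> T a"
    by (rule bracket_of_inversions[of "n+1" "2*n" "occurs_before x", OF dl tl]) blast+
  have "\<exists>t. n \<le> t \<and> t \<le> 2 * n \<and> (\<forall>c\<in>?R. occurs_before x c (?bar d) \<longleftrightarrow> c \<le> t)" if d: "d \<in> ?R" for d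
  proof -
    have dn: "occurs_before x c (?bar d)"
      if "n < c" "c < c'" "c' \<le> 2 * n" "occurs_before x c' (?bar d)" for c c'
      using down[of "?bar d" c c'] that d by auto
    obtain t where "n \<le> t" "t \<le> 2 * n" "\<And>c. n < c \<Longrightarrow> c \<le> 2 * n \<Longrightarrow> occurs_before x c (?bar d) \<longleftrightarrow> c \<le> t"
      by (rule initial_segment_bound[of n "2 * n" "\<lambda>c. occurs_before x c (?bar d)"])
        (use dn in simp, blast intro: dn, blast)
    then show ?thesis by auto
  qed
  then obtain S where S: "\<And>d. d \<in> ?R \<Longrightarrow> n \<le> S d \<and> S d \<le> 2 * n \<and>
      (\<forall>c\<in>?R. occurs_before x c (?bar d) \<longleftrightarrow> c \<le> S d)"
    by metis
  have enc: "encodes_B n x T S" using T(2) S by (simp add: encodes_B_def)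
  have sym: "d \<le> S c" if c: "c \<in> ?R" and d: "d \<in> ?R" and le: "c \<le> S d" for c d
  proof -
    have "occurs_before x c (?bar d)" using S c d le by blast
    then have "occurs_before x (?bar (?bar d)) (?bar c)" by (rule occurs_before_mirror[OF x])
    then show ?thesis using S[OF c] d by auto
  qed
  have "tamari_pair n T S"
    unfolding tamari_pair_def
  proof (intro conjI ballI impI)
    show "bracket (n+1) (2*n) T" by (rule T)
    fix d assume d: "d \<in> ?R"
    show "n \<le> S d" "S d \<le> 2 * n" using S[OF d] by auto
  next
    fix c d assume "c \<in> ?R" "d \<in> ?R"
    then show "c \<le> S d \<longleftrightarrow> d \<le> S c" using sym by blast
  next
    fix a d assume a: "a \<in> ?R" and d: "d \<in> ?R" and le: "a \<le> S d"
    have a': "n + 1 \<le> a" "a \<le> 2 * n" using a by auto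
    note D = bracketD[OF T(1) a']
    show "T a \<le> S d"
    proof (cases "T a = a")
      case False
      then have "occurs_before x (T a) a" using T(2)[of a "T a"] D(1,2) a' by simp
      moreover have "occurs_before x a (?bar d)" using S[OF d] a le by blast
      ultimately have "occurs_before x (T a) (?bar d)" using occurs_before_trans[OF xl(1)] by blast
      then show ?thesis using S[OF d] D(1,2) a' by auto
    qed (use le in simp)
  qed
  then show ?thesis using that enc by blast
qed

lemma exists_encoded_B:
  assumes TS: "tamari_pair n T S"
  obtains x where "x \<in> avoiders_B n" "encodes_B n x T S"
proof -
  let ?R = "{n+1..2*n}"
  let ?bar = "\<lambda>v::nat. 2 * n + 1 - v"
  \<comment> \<open>The cases are: both values large, only \<open>b\<close> large, both small. The
    last one is read off from the mirror image.\<close>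
  define I where "I b a \<longleftrightarrow> (if n < a then b \<le> T a else if n < b then b \<le> S (?bar a) else ?bar a \<le> T (?bar b))" for b a
  note closed = pair_closed[OF TS] and sym = pair_sym[OF TS] and br = bracketD(3)[OF pair_bracket[OF TS]]
  have barR: "?bar a \<in> ?R" if "1 \<le> a" "a \<le> n" for a using that by auto
  have tr: "I c a" if R: "1 \<le> a" "a < b" "b < c" "c \<le> 2 * n" and cb: "I c b" and ba: "I b a" for a b c
  proof -
    consider "n < a" | "a \<le> n" "n < b" | "b \<le> n" "n < c" | "c \<le> n" by linarith
    then show ?thesis
    proof cases
      case 1
      then show ?thesis using br[of a b] R cb ba by (simp add: I_def)
    next
      case 2
      then show ?thesis using closed[of b "?bar a"] barR[of a] R cb ba by (simp add: I_def)
    next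
      case 3
      have a: "?bar a \<in> ?R" and b: "?bar b \<in> ?R" and c: "c \<in> ?R" using barR 3 R by auto
      \<comment> \<open>Transposing to row \<open>c\<close> makes closure applicable to the large
        value \<open>?bar b\<close>, whose arc reaches \<open>?bar a\<close>.\<close>
      have "?bar b \<le> S c" using sym[OF c b] cb 3 R by (simp add: I_def)
      then have "T (?bar b) \<le> S c" using closed[OF b c] by blast
      then have "?bar a \<le> S c" using ba 3 R by (simp add: I_def)
      then show ?thesis using sym[OF a c] 3 R by (simp add: I_def)
    next
      case 4
      have "T (?bar b) \<le> T (?bar c)"
        by (rule br) (use 4 R cb in \<open>auto simp: I_def\<close>)
      then show ?thesis using 4 R ba by (simp add: I_def)
    qed
  qed
  have co: "I c b \<or> I b a" if R: "1 \<le> a" "a < b" "b < c" "c \<le> 2 * n" and ca: "I c a" for a b c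
  proof -
    consider "n < a" | "a \<le> n" "n < b" | "b \<le> n" "n < c" | "c \<le> n" by linarith
    then show ?thesis
    proof cases
      case 3
      have a: "?bar a \<in> ?R" and b: "?bar b \<in> ?R" and c: "c \<in> ?R" using barR 3 R by auto
      have "?bar a \<le> S c" using sym[OF a c] ca 3 R by (simp add: I_def)
      then have "?bar b \<le> S c" using R by simp
      then show ?thesis using sym[OF c b] 3 R by (simp add: I_def)
    qed (use ca R in \<open>auto simp: I_def\<close>)
  qed
  obtain x where x: "x \<in> permutations_of_set {1..2*n}"
    and ob: "\<And>a b. 1 \<le> a \<Longrightarrow> a < b \<Longrightarrow> b \<le> 2 * n \<Longrightarrow> occurs_before x b a \<longleftrightarrow> I b a"
    by (rule exists_permutation_of_inversions[of "2*n" I]) (use tr co in blast)+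
  have dx: "distinct x" "set x = {1..2*n}" using x by (auto simp: permutations_of_set_def)
  have xB: "x \<in> B_perms n"
  proof (rule B_perms_of_symmetric_inversions[OF x])
    fix a b assume ab: "a < b" and o1: "occurs_before x b a"
    have R: "1 \<le> a" "b \<le> 2 * n" using occurs_before_in_set[OF o1] dx by auto
    have iba: "I b a" using ob R ab o1 by blast
    have "I (?bar a) (?bar b)"
    proof -
      consider "n < a" | "a \<le> n" "n < b" | "b \<le> n" by linarith
      then show ?thesis
      proof cases
        case 2
        then show ?thesis using sym[of b "?bar a"] iba R by (auto simp: I_def)
      qed (use iba R ab in \<open>auto simp: I_def\<close>)
    qed
    moreover have "1 \<le> ?bar b" "?bar b < ?bar a" "?bar a \<le> 2 * n" using R ab by auto
    ultimately show "occurs_before x (?bar a) (?bar b)" using ob by blast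
  qed
  have "\<not> contains_312_star n x"
  proof
    assume "contains_312_star n x"
    then obtain i j k where ijk: "i < j" "j < k" "k < length x" "x ! j < x ! k" "x ! k < x ! i" "n + 1 \<le> x ! k"
      unfolding contains_312_star_def by blast
    have R: "x ! j \<in> {1..2*n}" "x ! i \<in> {1..2*n}" using ijk nth_mem[of j x] nth_mem[of i x] dx by auto
    have "occurs_before x (x ! i) (x ! j)" using occurs_before_nth[OF dx(1), of i j] ijk by simp
    then have "I (x ! i) (x ! j)" using ob R ijk by auto
    \<comment> \<open>\<open>x ! k\<close> is large, so one of the first two clauses of
      \<open>I\<close> applies, and these are downward closed in the large value.\<close>
    then have "I (x ! k) (x ! j)" using ijk by (auto simp: I_def split: if_splits)
    then have "occurs_before x (x ! k) (x ! j)" using ob[of "x ! j" "x ! k"] R ijk by auto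
    then show False using occurs_before_nth[OF dx(1), of k j] ijk by simp
  qed
  then have "x \<in> avoiders_B n" using xB by (simp add: avoiders_B_def)
  moreover have "encodes_B n x T S"
    unfolding encodes_B_def
  proof (intro conjI allI impI ballI)
    fix a c assume "n + 1 \<le> a \<and> a < c \<and> c \<le> 2 * n"
    then show "occurs_before x c a \<longleftrightarrow> c \<le> T a" using ob[of a c] by (simp add: I_def)
  next
    fix c d assume cd: "c \<in> ?R" "d \<in> ?R"
    then have "\<not> n < ?bar d" "n < c" "?bar (?bar d) = d" "1 \<le> ?bar d" "?bar d < c" "c \<le> 2 * n"
      by auto
    then show "occurs_before x c (?bar d) \<longleftrightarrow> c \<le> S d" using ob[of "?bar d" c] by (simp only: I_def if_False if_True)
  qed
  ultimately show ?thesis using that by blast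
qed

lemma weak_le_encodes_B:
  assumes xA: "x \<in> avoiders_B n" and yA: "y \<in> avoiders_B n"
    and X: "tamari_pair n T S" "encodes_B n x T S" and Y: "tamari_pair n T' S'" "encodes_B n y T' S'"
  shows "weak_le x y \<longleftrightarrow> (\<forall>a\<in>{n+1..2*n}. T a \<le> T' a) \<and> (\<forall>d\<in>{n+1..2*n}. S d \<le> S' d)"
proof
  let ?bar = "\<lambda>v::nat. 2 * n + 1 - v"
  assume le: "weak_le x y"
  have "T a \<le> T' a" if a: "a \<in> {n+1..2*n}" for a
  proof -
    have a': "n + 1 \<le> a" "a \<le> 2 * n" using a by auto
    note D = bracketD[OF pair_bracket[OF X(1)] a'] and E = bracketD[OF pair_bracket[OF Y(1)] a']
    show ?thesis
    proof (cases "T a = a")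
      case False
      then have "occurs_before x (T a) a" using encodes_BD(1)[OF X(2), of a "T a"] D(1,2) a' by simp
      then have "occurs_before y (T a) a" using le False D(1) unfolding weak_le_def by auto
      then show ?thesis using encodes_BD(1)[OF Y(2), of a "T a"] False D(1,2) a' by simp
    qed (use E in simp)
  qed
  moreover have "S d \<le> S' d" if d: "d \<in> {n+1..2*n}" for d
  proof (cases "S d = n")
    case True
    then show ?thesis using pair_range(1)[OF Y(1) d] by simp
  next
    case False
    then have R: "S d \<in> {n+1..2*n}" using pair_range[OF X(1) d] by simp
    have "occurs_before x (S d) (?bar d)" using encodes_BD(2)[OF X(2) R d] by simp
    moreover have "?bar d < S d" using d R by auto
    ultimately have "occurs_before y (S d) (?bar d)" using le unfolding weak_le_def by blast
    then show ?thesis using encodes_BD(2)[OF Y(2) R d] by simp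
  qed
  ultimately show "(\<forall>a\<in>{n+1..2*n}. T a \<le> T' a) \<and> (\<forall>d\<in>{n+1..2*n}. S d \<le> S' d)" by blast
next
  let ?bar = "\<lambda>v::nat. 2 * n + 1 - v"
  assume le: "(\<forall>a\<in>{n+1..2*n}. T a \<le> T' a) \<and> (\<forall>d\<in>{n+1..2*n}. S d \<le> S' d)"
  have x: "x \<in> B_perms n" and y: "y \<in> B_perms n" using xA yA by (auto simp: avoiders_B_def)
  have large: "occurs_before y b a" if "n < a" "a < b" "occurs_before x b a" for a b
  proof -
    have R: "n + 1 \<le> a" "b \<le> 2 * n" using that occurs_before_in_set[OF that(3)] B_perms_list(2)[OF x] by auto
    then have "b \<le> T a" using encodes_BD(1)[OF X(2)] that by blast
    then have "b \<le> T' a" using le R that by (metis atLeastAtMost_iff le_trans less_imp_le)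
    then show ?thesis using encodes_BD(1)[OF Y(2)] that R by blast
  qed
  show "weak_le x y"
    unfolding weak_le_def
  proof (intro allI impI, elim conjE)
    fix a b assume ab: "a < b" and ob: "occurs_before x b a"
    have R: "1 \<le> a" "b \<le> 2 * n" using occurs_before_in_set[OF ob] B_perms_list(2)[OF x] by auto
    consider "n < a" | "a \<le> n" "n < b" | "b \<le> n" by linarith
    then show "occurs_before y b a"
    proof cases
      case 1
      then show ?thesis using large ab ob by blast
    next
      case 2
      then have Q: "b \<in> {n+1..2*n}" "?bar a \<in> {n+1..2*n}" "?bar (?bar a) = a" using R by auto
      then have "b \<le> S (?bar a)" using encodes_BD(2)[OF X(2) Q(1,2)] ob by simp
      then have "b \<le> S' (?bar a)" using le Q le_trans by blast
      then show ?thesis using encodes_BD(2)[OF Y(2) Q(1,2)] Q(3) by simp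
    next
      case 3
      have Q: "n < ?bar b" "?bar b < ?bar a" "?bar (?bar a) = a" "?bar (?bar b) = b" using 3 ab R by auto
      have "occurs_before y (?bar a) (?bar b)" using large[OF Q(1,2)] occurs_before_mirror[OF x ob] by blast
      then show ?thesis using occurs_before_mirror[OF y] Q(3,4) by metis
    qed
  qed
qed

section \<open>Pairs covered by a given pair\<close>

text \<open>Only a preorder, as the functions are arbitrary outside \<open>{n+1..2*n}\<close>; hence
  equality of pairs appears below as two inequalities.\<close>

definition pair_le :: "nat \<Rightarrow> (nat \<Rightarrow> nat) \<times> (nat \<Rightarrow> nat) \<Rightarrow> (nat \<Rightarrow> nat) \<times> (nat \<Rightarrow> nat) \<Rightarrow> bool" where
  "pair_le n X Y \<longleftrightarrow> (\<forall>a\<in>{n+1..2*n}. fst X a \<le> fst Y a) \<and> (\<forall>d\<in>{n+1..2*n}. snd X d \<le> snd Y d)"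

definition lower_pairs :: "nat \<Rightarrow> (nat \<Rightarrow> nat) \<Rightarrow> (nat \<Rightarrow> nat) \<Rightarrow> ((nat \<Rightarrow> nat) \<times> (nat \<Rightarrow> nat)) set" where
  "lower_pairs n T S =
     (\<lambda>a. (T(a := pop_bracket T a), S)) ` {a \<in> {n+1..2*n}. T a \<noteq> a} \<union>
     (\<lambda>d. (T, pop_shape_on n T S (corner S d))) ` {d \<in> {n+1..2*n}. n < S d}"

lemma lower_pairs_cases:
  assumes "(U, W) \<in> lower_pairs n T S"
  obtains (bracket) a where "a \<in> {n+1..2*n}" "T a \<noteq> a" "U = T(a := pop_bracket T a)" "W = S"
  | (shape) d where "d \<in> {n+1..2*n}" "n < S d" "U = T" "W = pop_shape_on n T S (corner S d)"
  using assms unfolding lower_pairs_def by blast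

context
  fixes n :: nat and T S :: "nat \<Rightarrow> nat"
  assumes TS: "tamari_pair n T S"
begin

lemma pop_bracket_pair_bounds:
  assumes "a \<in> {n+1..2*n}"
  shows "pop_bracket T a \<le> T a" "T a \<noteq> a \<Longrightarrow> pop_bracket T a < T a"
  using pop_bracket_bounds[OF pair_bracket[OF TS], of a] assms by simp_all

lemma pop_shape_on_bounds:
  assumes "d \<in> {n+1..2*n}"
  shows "pop_shape n T S d \<le> pop_shape_on n T S Q d" "pop_shape_on n T S Q d \<le> S d"
  using pop_shape_le[OF TS assms] by (auto simp: pop_shape_on_def)

lemma lower_pairs_below:
  assumes L: "(U, W) \<in> lower_pairs n T S"
  shows "tamari_pair n U W" "pair_le n (U, W) (T, S)" "\<not> pair_le n (T, S) (U, W)"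
    "pair_le n (pop_bracket T, pop_shape n T S) (U, W)"
proof -
  from L have "tamari_pair n U W \<and> pair_le n (U, W) (T, S) \<and> \<not> pair_le n (T, S) (U, W) \<and>
    pair_le n (pop_bracket T, pop_shape n T S) (U, W)"
  proof (cases rule: lower_pairs_cases)
    case (bracket a)
    have "tamari_pair n U W"
      unfolding bracket(3,4)
      by (rule tamari_pair_smaller_bracket[OF TS bracket_pop_at[OF pair_bracket[OF TS]]])
        (use bracket(1) pop_bracket_pair_bounds(1) in auto)
    moreover have "\<not> T a \<le> U a" using pop_bracket_pair_bounds(2)[OF bracket(1,2)] bracket(3) by simp
    then have "\<not> pair_le n (T, S) (U, W)" using bracket(1) unfolding pair_le_def fst_conv by blast
    ultimately show ?thesis
      using pop_bracket_pair_bounds(1) pop_shape_le[OF TS] bracket by (simp add: pair_le_def)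
  next
    case (shape d)
    obtain e where e: "e \<in> {n+1..2*n}" "W e < S e"
      using corner_proper[OF TS shape(1,2)] shape(4) by blast
    then have "\<not> pair_le n (T, S) (U, W)" unfolding pair_le_def snd_conv by (meson not_le)
    then show ?thesis
      using tamari_pair_corner[OF TS shape(1,2)] shape(3,4) pop_shape_on_bounds pop_bracket_pair_bounds(1)
      by (simp add: pair_le_def)
  qed
  then show "tamari_pair n U W" "pair_le n (U, W) (T, S)" "\<not> pair_le n (T, S) (U, W)"
    "pair_le n (pop_bracket T, pop_shape n T S) (U, W)" by blast+
qed

lemma lower_pairs_cover:
  assumes L: "(U, W) \<in> lower_pairs n T S" and P: "tamari_pair n T1 S1"
    and low: "pair_le n (U, W) (T1, S1)" and up: "pair_le n (T1, S1) (T, S)"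
  shows "pair_le n (T1, S1) (U, W) \<or> pair_le n (T, S) (T1, S1)"
  using L
proof (cases rule: lower_pairs_cases)
  case (bracket a)
  have S1: "S1 d = S d" if "d \<in> {n+1..2*n}" for d
    using low up that bracket(4) by (auto simp: pair_le_def intro: antisym)
  have T1: "T1 b = T b" if "b \<in> {n+1..2*n}" "b \<noteq> a" for b
  proof (rule antisym)
    show "T1 b \<le> T b" using up that(1) by (simp add: pair_le_def)
    have "U b \<le> T1 b" using low that(1) by (simp add: pair_le_def)
    then show "T b \<le> T1 b" using that(2) bracket(3) by simp
  qed
  have a: "n + 1 \<le> a" "a \<le> 2 * n" using bracket(1) by auto
  have "U a \<le> T1 a" "T1 a \<le> T a" using low up bracket(1) by (simp_all add: pair_le_def)
  then have "T1 a = pop_bracket T a \<or> T1 a = T a"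
    using bracket_pop_at_cover[OF pair_bracket[OF TS] a pair_bracket[OF P]] T1 bracket(3) by simp
  then show ?thesis
  proof
    assume "T1 a = pop_bracket T a"
    then have "pair_le n (T1, S1) (U, W)" using T1 S1 bracket(3,4) by (simp add: pair_le_def)
    then show ?thesis ..
  next
    assume "T1 a = T a"
    then have "T b \<le> T1 b" if "b \<in> {n+1..2*n}" for b using T1[of b] that by (cases "b = a") simp_all
    then have "pair_le n (T, S) (T1, S1)" using S1 by (simp add: pair_le_def)
    then show ?thesis ..
  qed
next
  case (shape d)
  have T1: "T1 b = T b" if "b \<in> {n+1..2*n}" for b
    using low up that shape(3) by (auto simp: pair_le_def intro: antisym)
  have P': "tamari_pair n T S1" by (rule tamari_pair_cong[OF P]) (use T1 in auto)
  have "(\<forall>f\<in>{n+1..2*n}. S1 f = W f) \<or> (\<forall>f\<in>{n+1..2*n}. S1 f = S f)"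
    using corner_cover[OF TS P' shape(1,2)] low up shape(4) by (simp add: pair_le_def)
  then show ?thesis using T1 shape(3) by (auto simp: pair_le_def)
qed

text \<open>If the bracket function is smaller anywhere, shortening one arc suffices, whatever the
  shape does. Otherwise both shapes are compatible with the same \<open>T\<close>, as the corner
  lemmas require.\<close>

lemma lower_pairs_above:
  assumes P: "tamari_pair n T1 S1" and up: "pair_le n (T1, S1) (T, S)" and ne: "\<not> pair_le n (T, S) (T1, S1)"
  obtains U W where "(U, W) \<in> lower_pairs n T S" "pair_le n (T1, S1) (U, W)"
proof (cases "\<exists>a\<in>{n+1..2*n}. T1 a < T a")
  case True
  then obtain a0 where a0: "n + 1 \<le> a0" "a0 \<le> 2 * n" "T1 a0 < T a0" by auto
  have le: "T1 a \<le> T a" if "n + 1 \<le> a" "a \<le> 2 * n" for a using up that by (simp add: pair_le_def)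
  obtain a where a: "n + 1 \<le> a" "a \<le> 2 * n" "T a \<noteq> a" "T1 a \<le> pop_bracket T a"
    using bracket_below_pop_at[OF pair_bracket[OF TS] pair_bracket[OF P] le a0] by blast
  have "(T(a := pop_bracket T a), S) \<in> lower_pairs n T S" using a by (auto simp: lower_pairs_def)
  moreover have "pair_le n (T1, S1) (T(a := pop_bracket T a), S)" using up a by (simp add: pair_le_def)
  ultimately show ?thesis by (rule that)
next
  case False
  then have T1: "T1 b = T b" if "b \<in> {n+1..2*n}" for b
    using up that unfolding pair_le_def fst_conv by (meson le_neq_implies_less)
  have P': "tamari_pair n T S1" by (rule tamari_pair_cong[OF P]) (use T1 in auto)
  have le: "S1 f \<le> S f" if "f \<in> {n+1..2*n}" for f using up that by (simp add: pair_le_def)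
  have "\<exists>e\<in>{n+1..2*n}. S1 e < S e"
    using ne T1 by (auto simp: pair_le_def not_le)
  then obtain e where e: "e \<in> {n+1..2*n}" "S1 e < S e" by blast
  obtain d where d: "d \<in> {n+1..2*n}" "n < S d"
    "\<And>f. f \<in> {n+1..2*n} \<Longrightarrow> S1 f \<le> pop_shape_on n T S (corner S d) f"
    using corner_below[OF TS P' le e] by blast
  have "(T, pop_shape_on n T S (corner S d)) \<in> lower_pairs n T S"
    using d(1,2) by (simp add: lower_pairs_def)
  moreover have "pair_le n (T1, S1) (T, pop_shape_on n T S (corner S d))"
    using d(3) T1 by (simp add: pair_le_def)
  ultimately show ?thesis by (rule that)
qed

text \<open>Every value of the popped pair that differs from the old one is attained in some lower
  pair: at \<open>a\<close> by shortening its arc, at \<open>d\<close> by removing its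
  corner.\<close>

lemma lower_pairs_meet:
  assumes P: "tamari_pair n T1 S1" and up: "pair_le n (T1, S1) (T, S)"
    and all: "\<And>U W. (U, W) \<in> lower_pairs n T S \<Longrightarrow> pair_le n (T1, S1) (U, W)"
  shows "pair_le n (T1, S1) (pop_bracket T, pop_shape n T S)"
  unfolding pair_le_def fst_conv snd_conv
proof (intro conjI ballI)
  fix a assume a: "a \<in> {n+1..2*n}"
  show "T1 a \<le> pop_bracket T a"
  proof (cases "T a = a")
    case True
    have "T1 a \<le> T a" using up a by (simp add: pair_le_def)
    then show ?thesis using True by (simp add: pop_bracket_def)
  next
    case False
    then have "(T(a := pop_bracket T a), S) \<in> lower_pairs n T S" using a by (simp add: lower_pairs_def)
    then have "T1 a \<le> (T(a := pop_bracket T a)) a" using all a unfolding pair_le_def fst_conv by blast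
    then show ?thesis by simp
  qed
next
  fix d assume d: "d \<in> {n+1..2*n}"
  show "S1 d \<le> pop_shape n T S d"
  proof (cases "n < S d")
    case False
    have "S1 d \<le> S d" using up d by (simp add: pair_le_def)
    then show ?thesis using False by (simp add: pop_shape_def)
  next
    case True
    then have "(T, pop_shape_on n T S (corner S d)) \<in> lower_pairs n T S"
      using d by (simp add: lower_pairs_def)
    then have "S1 d \<le> pop_shape_on n T S (corner S d) d" using all d unfolding pair_le_def snd_conv by blast
    then show ?thesis by (simp add: pop_shape_on_def corner_def)
  qed
qed

end

lemma weak_le_iff_pair_le:
  assumes "x \<in> avoiders_B n" "y \<in> avoiders_B n"
    and "tamari_pair n T S" "encodes_B n x T S" "tamari_pair n T' S'" "encodes_B n y T' S'"
  shows "weak_le x y \<longleftrightarrow> pair_le n (T, S) (T', S')"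
  using weak_le_encodes_B[OF assms] by (simp add: pair_le_def)

lemma avoiders_B_antisym:
  "x \<in> avoiders_B n \<Longrightarrow> y \<in> avoiders_B n \<Longrightarrow> weak_le x y \<Longrightarrow> weak_le y x \<Longrightarrow> x = y"
  using weak_le_antisym B_perms_permutation unfolding avoiders_B_def by blast

lemma Pop_B_encoded:
  assumes x: "x \<in> avoiders_B n" and TS: "tamari_pair n T S" "encodes_B n x T S"
    and p: "p \<in> avoiders_B n" "encodes_B n p (pop_bracket T) (pop_shape n T S)"
  shows "Pop (weak_order (avoiders_B n)) x = p"
proof (rule Pop_weak_order_eqI[where Y = "{y \<in> avoiders_B n.
      \<exists>U W. (U, W) \<in> lower_pairs n T S \<and> encodes_B n y U W}"])
  let ?Y = "{y \<in> avoiders_B n. \<exists>U W. (U, W) \<in> lower_pairs n T S \<and> encodes_B n y U W}"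
  note L = lower_pairs_below[OF TS(1)] and Pp = tamari_pair_pop[OF TS(1)]
  show "x \<in> avoiders_B n" "p \<in> avoiders_B n" by fact+
  show "u = v" if "u \<in> avoiders_B n" "v \<in> avoiders_B n" "weak_le u v" "weak_le v u" for u v
    using avoiders_B_antisym that by blast
  show "?Y \<subseteq> avoiders_B n" by blast
  show "weak_le y x" if y: "y \<in> ?Y" for y
  proof -
    obtain U W where UW: "y \<in> avoiders_B n" "(U, W) \<in> lower_pairs n T S" "encodes_B n y U W" using y by blast
    show ?thesis using weak_le_iff_pair_le[OF UW(1) x L(1)[OF UW(2)] UW(3) TS] L(2)[OF UW(2)] by blast
  qed
  show "weak_le p y" if y: "y \<in> ?Y" for y
  proof -
    obtain U W where UW: "y \<in> avoiders_B n" "(U, W) \<in> lower_pairs n T S" "encodes_B n y U W" using y by blast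
    show ?thesis using weak_le_iff_pair_le[OF p(1) UW(1) Pp p(2) L(1)[OF UW(2)] UW(3)] L(4)[OF UW(2)] by blast
  qed
  show "x \<notin> ?Y"
  proof
    assume "x \<in> ?Y"
    then obtain U W where UW: "(U, W) \<in> lower_pairs n T S" "encodes_B n x U W" by blast
    have "weak_le x x" by (simp add: weak_le_def)
    then show False
      using weak_le_iff_pair_le[OF x x TS L(1)[OF UW(1)] UW(2)] L(3)[OF UW(1)] by blast
  qed
  show "w = y \<or> w = x" if y: "y \<in> ?Y" and w: "w \<in> avoiders_B n" and le: "weak_le y w" "weak_le w x" for y w
  proof -
    obtain U W where UW: "y \<in> avoiders_B n" "(U, W) \<in> lower_pairs n T S" "encodes_B n y U W" using y by blast
    note PL = L(1)[OF UW(2)]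
    obtain T1 S1 where 1: "tamari_pair n T1 S1" "encodes_B n w T1 S1" using avoiders_B_encoded[OF w] by blast
    have "pair_le n (U, W) (T1, S1)" using weak_le_iff_pair_le[OF UW(1) w PL UW(3) 1] le by blast
    moreover have "pair_le n (T1, S1) (T, S)" using weak_le_iff_pair_le[OF w x 1 TS] le by blast
    ultimately have "pair_le n (T1, S1) (U, W) \<or> pair_le n (T, S) (T1, S1)"
      by (rule lower_pairs_cover[OF TS(1) UW(2) 1(1)])
    then have "weak_le w y \<or> weak_le x w"
      using weak_le_iff_pair_le[OF w UW(1) 1 PL UW(3)] weak_le_iff_pair_le[OF x w TS 1] by blast
    then show ?thesis using avoiders_B_antisym[OF w UW(1)] avoiders_B_antisym[OF w x] le by blast
  qed
  show "\<exists>y\<in>?Y. weak_le z y" if z: "z \<in> avoiders_B n" "weak_le z x" "z \<noteq> x" for z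
  proof -
    obtain T1 S1 where 1: "tamari_pair n T1 S1" "encodes_B n z T1 S1" using avoiders_B_encoded[OF z(1)] by blast
    have up: "pair_le n (T1, S1) (T, S)" using weak_le_iff_pair_le[OF z(1) x 1 TS] z(2) by blast
    have "\<not> pair_le n (T, S) (T1, S1)"
      using weak_le_iff_pair_le[OF x z(1) TS 1] avoiders_B_antisym[OF z(1) x] z by blast
    then obtain U W where UW: "(U, W) \<in> lower_pairs n T S" "pair_le n (T1, S1) (U, W)"
      using lower_pairs_above[OF TS(1) 1(1) up] by blast
    obtain y where y: "y \<in> avoiders_B n" "encodes_B n y U W" using exists_encoded_B[OF L(1)[OF UW(1)]] by blast
    then have "weak_le z y" using weak_le_iff_pair_le[OF z(1) y(1) 1 L(1)[OF UW(1)] y(2)] UW(2) by blast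
    then show ?thesis using y UW(1) by blast
  qed
  show "weak_le p x"
    using weak_le_iff_pair_le[OF p(1) x Pp p(2) TS] pop_bracket_pair_bounds(1)[OF TS(1)] pop_shape_le[OF TS(1)]
    by (simp add: pair_le_def)
  show "weak_le z p" if z: "z \<in> avoiders_B n" "weak_le z x" "\<And>y. y \<in> ?Y \<Longrightarrow> weak_le z y" for z
  proof -
    obtain T1 S1 where 1: "tamari_pair n T1 S1" "encodes_B n z T1 S1" using avoiders_B_encoded[OF z(1)] by blast
    have up: "pair_le n (T1, S1) (T, S)" using weak_le_iff_pair_le[OF z(1) x 1 TS] z(2) by blast
    have "pair_le n (T1, S1) (U, W)" if UW: "(U, W) \<in> lower_pairs n T S" for U W
    proof -
      obtain y where y: "y \<in> avoiders_B n" "encodes_B n y U W" using exists_encoded_B[OF L(1)[OF UW]] by blast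
      then have "weak_le z y" using z(3)[of y] UW by blast
      then show ?thesis using weak_le_iff_pair_le[OF z(1) y(1) 1 L(1)[OF UW] y(2)] by blast
    qed
    then have "pair_le n (T1, S1) (pop_bracket T, pop_shape n T S)"
      using lower_pairs_meet[OF TS(1) 1(1) up] by blast
    then show ?thesis using weak_le_iff_pair_le[OF z(1) p(1) 1 Pp p(2)] by blast
  qed
qed

lemma Pop_B_image_iff:
  assumes x: "x \<in> avoiders_B n" and TS: "tamari_pair n T S" "encodes_B n x T S"
  shows "x \<in> Pop (weak_order (avoiders_B n)) ` avoiders_B n \<longleftrightarrow>
    (\<exists>T0 S0. tamari_pair n T0 S0 \<and> (\<forall>a\<in>{n+1..2*n}. T a = pop_bracket T0 a) \<and>
      (\<forall>d\<in>{n+1..2*n}. S d = pop_shape n T0 S0 d))" (is "?L \<longleftrightarrow> ?R")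
proof
  assume ?L
  then obtain v where v: "v \<in> avoiders_B n" "x = Pop (weak_order (avoiders_B n)) v" by blast
  obtain T0 S0 where 0: "tamari_pair n T0 S0" "encodes_B n v T0 S0" using avoiders_B_encoded[OF v(1)] by blast
  note P = tamari_pair_pop[OF 0(1)]
  obtain p where p: "p \<in> avoiders_B n" "encodes_B n p (pop_bracket T0) (pop_shape n T0 S0)"
    using exists_encoded_B[OF P] by blast
  have px: "p = x" using Pop_B_encoded[OF v(1) 0 p] v(2) by simp
  have "weak_le x x" by (simp add: weak_le_def)
  then have "pair_le n (T, S) (pop_bracket T0, pop_shape n T0 S0)"
    "pair_le n (pop_bracket T0, pop_shape n T0 S0) (T, S)"
    using weak_le_iff_pair_le[OF x x TS P] weak_le_iff_pair_le[OF x x P _ TS] p(2) px by blast+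
  then show ?R using 0(1) unfolding pair_le_def fst_conv snd_conv by (meson le_antisym)
next
  assume ?R
  then obtain T0 S0 where 0: "tamari_pair n T0 S0" "\<forall>a\<in>{n+1..2*n}. T a = pop_bracket T0 a"
    "\<forall>d\<in>{n+1..2*n}. S d = pop_shape n T0 S0 d" by blast
  obtain v where v: "v \<in> avoiders_B n" "encodes_B n v T0 S0" using exists_encoded_B[OF 0(1)] by blast
  have "encodes_B n x (pop_bracket T0) (pop_shape n T0 S0)"
    using TS(2) 0(2,3) by (simp add: encodes_B_def)
  then have "Pop (weak_order (avoiders_B n)) v = x" using Pop_B_encoded[OF v(1) 0(1) v(2) x] by blast
  then show ?L using v(1) by blast
qed

section \<open>Halves\<close>

lemma maximal_large_block_exists:
  assumes p: "p < length x" "n + 1 \<le> x ! p"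
  obtains i j where "maximal_large_block n x i j" "i \<le> p" "p < j"
proof -
  let ?P = "\<lambda>i. i \<le> p \<and> (\<forall>l. i \<le> l \<and> l \<le> p \<longrightarrow> n + 1 \<le> x ! l)"
  let ?Q = "\<lambda>j. p < j \<and> j \<le> length x \<and> (\<forall>l. p \<le> l \<and> l < j \<longrightarrow> n + 1 \<le> x ! l)"
  define i where "i = (LEAST i. ?P i)"
  define j where "j = (GREATEST j. ?Q j)"
  have Pp: "?P p" using p by (auto dest: le_antisym)
  have i: "?P i" unfolding i_def by (rule LeastI[of ?P, OF Pp])
  have imin: "i \<le> i'" if "?P i'" for i' unfolding i_def by (rule Least_le[of ?P, OF that])
  have Qp: "?Q (Suc p)" using p by (auto dest: le_antisym simp: less_Suc_eq_le)
  have j: "?Q j" unfolding j_def by (rule GreatestI_nat[of ?Q, OF Qp, of "length x"]) blast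
  have jmax: "j' \<le> j" if "?Q j'" for j'
    unfolding j_def by (rule Greatest_le_nat[of ?Q, OF that, of "length x"]) blast
  have "maximal_large_block n x i j"
    unfolding maximal_large_block_def large_block_def
  proof (intro conjI allI impI)
    show "i < j" "j \<le> length x" using i j by auto
    show "n + 1 \<le> x ! l" if "i \<le> l \<and> l < j" for l using i j that by (metis nat_le_linear)
    fix i' j' assume b: "(i' < j' \<and> j' \<le> length x \<and> (\<forall>l. i' \<le> l \<and> l < j' \<longrightarrow> n + 1 \<le> x ! l)) \<and> i' \<le> i \<and> j \<le> j'"
    have "?P i'" using b i j by (meson le_less_trans le_trans less_le_trans)
    then show "i' = i" using imin b by (meson le_antisym)
    have "?Q j'" using b i j by (meson le_less_trans le_trans less_le_trans)
    then show "j' = j" using jmax b by (meson le_antisym)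
  qed
  then show ?thesis using that i j by blast
qed

lemma maximal_large_block_boundary:
  assumes "maximal_large_block n x i j"
  shows "j < length x \<Longrightarrow> x ! j \<le> n" "0 < i \<Longrightarrow> x ! (i - 1) \<le> n"
proof -
  have b: "large_block n x i j" and mx: "\<And>i' j'. large_block n x i' j' \<Longrightarrow> i' \<le> i \<Longrightarrow> j \<le> j' \<Longrightarrow> i' = i \<and> j' = j"
    using assms unfolding maximal_large_block_def by blast+
  show "x ! j \<le> n" if "j < length x"
  proof (rule ccontr)
    assume "\<not> x ! j \<le> n"
    then have "large_block n x i (Suc j)"
      using b that unfolding large_block_def by (auto simp: less_Suc_eq)
    then show False using mx[of i "Suc j"] by simp
  qed
  show "x ! (i - 1) \<le> n" if "0 < i"
  proof (rule ccontr)
    assume neg: "\<not> x ! (i - 1) \<le> n"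
    have "n + 1 \<le> x ! l" if "i - 1 \<le> l" "l < j" for l
      using b neg that unfolding large_block_def by (cases "l = i - 1") auto
    then have "large_block n x (i - 1) j" using b unfolding large_block_def by auto
    then show False using mx[of "i - 1" j] that by simp
  qed
qed

text \<open>Small values are the mirror images of large ones, so \<open>S c\<close> records which
  small entries follow \<open>c\<close>. Entries of one block are followed by the same small
  entries, while a small entry separates any two blocks.\<close>

lemma maximal_large_block_level:
  assumes x: "x \<in> B_perms n" and TS: "tamari_pair n T S" "encodes_B n x T S"
    and b: "maximal_large_block n x i j" and q: "i \<le> q" "q < j"
  shows "set (take (j - i) (drop i x)) = level n S (S (x ! q))"
proof -
  let ?bar = "\<lambda>v::nat. 2 * n + 1 - v"
  note xl = B_perms_list[OF x] and bd = maximal_large_block_boundary[OF b]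
  have lb: "i < j" "j \<le> length x" "\<And>l. i \<le> l \<Longrightarrow> l < j \<Longrightarrow> n + 1 \<le> x ! l"
    using b unfolding maximal_large_block_def large_block_def by auto
  have R: "x ! l \<in> {n+1..2*n}" if "i \<le> l" "l < j" for l
    using lb(3)[OF that] nth_mem[of l x] that lb(2) xl(2) by auto
  have small: "?bar d \<in> set x" "?bar d \<le> n" if "d \<in> {n+1..2*n}" for d
    using that xl(2) by auto
  have before: "occurs_before x (x ! l) (?bar d) \<longleftrightarrow> occurs_before x (x ! q) (?bar d)"
    if l: "i \<le> l" "l < j" and d: "d \<in> {n+1..2*n}" for l d
  proof -
    obtain k where k: "k < length x" "x ! k = ?bar d" using small(1)[OF d] in_set_conv_nth by metis
    have "\<not> (i \<le> k \<and> k < j)" using lb(3)[of k] small(2)[OF d] k(2) by auto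
    then have "l < k \<longleftrightarrow> q < k" using l q by auto
    then show ?thesis using occurs_before_nth[OF xl(1), of _ k] k l q lb(2) by auto
  qed
  have iff: "x ! l \<le> S d \<longleftrightarrow> x ! q \<le> S d" if "i \<le> l" "l < j" "d \<in> {n+1..2*n}" for l d
    using before[OF that] encodes_BD(2)[OF TS(2) R that(3)] that q by blast
  have eq: "S (x ! l) = S (x ! q)" if l: "i \<le> l" "l < j" for l
  proof -
    have *: "d \<le> S (x ! l) \<longleftrightarrow> d \<le> S (x ! q)" if "d \<in> {n+1..2*n}" for d
      using iff[OF l that] pair_sym[OF TS(1) R[OF l] that] pair_sym[OF TS(1) R[OF q] that] by blast
    show ?thesis
      using *[of "S (x ! l)"] *[of "S (x ! q)"] pair_range[OF TS(1) R[OF l]] pair_range[OF TS(1) R[OF q]]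
      by (cases "S (x ! l) = n"; cases "S (x ! q) = n") auto
  qed
  have set_w: "set (take (j - i) (drop i x)) = (!) x ` {i..<j}"
  proof (intro equalityI subsetI)
    fix v assume "v \<in> set (take (j - i) (drop i x))"
    then obtain k where "k < j - i" "v = x ! (i + k)" using lb(2) by (auto simp: in_set_conv_nth)
    then show "v \<in> (!) x ` {i..<j}" by auto
  next
    fix v assume "v \<in> (!) x ` {i..<j}"
    then obtain k where k: "i \<le> k" "k < j" "v = x ! k" by auto
    then have "take (j - i) (drop i x) ! (k - i) = v" "k - i < length (take (j - i) (drop i x))"
      using lb(2) by auto
    then show "v \<in> set (take (j - i) (drop i x))" using nth_mem by metis
  qed
  show ?thesis
  proof (intro equalityI subsetI)
    fix c assume "c \<in> set (take (j - i) (drop i x))"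
    then obtain l where "i \<le> l" "l < j" "c = x ! l" unfolding set_w by auto
    then show "c \<in> level n S (S (x ! q))" using R eq by (simp add: level_def)
  next
    fix c assume "c \<in> level n S (S (x ! q))"
    then have c: "c \<in> {n+1..2*n}" "S c = S (x ! q)" by (auto simp: level_def)
    then obtain k where k: "k < length x" "x ! k = c" using xl(2) in_set_conv_nth[of c x] by auto
    have same: "occurs_before x c (?bar d) \<longleftrightarrow> occurs_before x (x ! q) (?bar d)" if "d \<in> {n+1..2*n}" for d
      using encodes_BD(2)[OF TS(2) c(1) that] encodes_BD(2)[OF TS(2) R[OF q] that]
        pair_sym[OF TS(1) c(1) that] pair_sym[OF TS(1) R[OF q] that] c(2) by simp
    have sep: "k < r \<longleftrightarrow> q < r" if r: "r < length x" "x ! r \<le> n" for r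
    proof -
      have "x ! r \<in> {1..2*n}" using r(1) nth_mem xl(2) by blast
      then have d: "?bar (x ! r) \<in> {n+1..2*n}" "?bar (?bar (x ! r)) = x ! r" using r(2) by auto
      show ?thesis
        using same[OF d(1)] d(2) occurs_before_nth[OF xl(1) _ r(1), of k] occurs_before_nth[OF xl(1) _ r(1), of q]
          k q lb(2) by simp
    qed
    have "k < j"
    proof (cases "j < length x")
      case True
      then show ?thesis using sep[of j] bd(1) q by simp
    qed (use k in simp)
    moreover have "i \<le> k"
    proof (rule ccontr)
      assume neg: "\<not> i \<le> k"
      then have "x ! (i - 1) \<le> n" "i - 1 < length x" using bd(2) lb by auto
      \<comment> \<open>This excludes only the positions before \<open>i - 1\<close>; the position
        \<open>i - 1\<close> itself carries a small value.\<close>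
      then have sp: "\<not> k < i - 1" using sep[of "i - 1"] q by simp
      then have "k = i - 1" using neg by simp
      then show False using k(2) c(1) \<open>x ! (i - 1) \<le> n\<close> by simp
    qed
    ultimately show "c \<in> set (take (j - i) (drop i x))" unfolding set_w using k(2) by auto
  qed
qed

lemma occurs_before_sublist:
  assumes x: "distinct x" and ij: "i \<le> j" "j \<le> length x"
    and ac: "a \<in> set (take (j - i) (drop i x))" "c \<in> set (take (j - i) (drop i x))"
  shows "occurs_before (take (j - i) (drop i x)) c a \<longleftrightarrow> occurs_before x c a"
proof -
  let ?w = "take (j - i) (drop i x)"
  have len: "length ?w = j - i" using ij by simp
  obtain k l where kl: "k < j - i" "l < j - i" "?w ! k = a" "?w ! l = c"
    using ac len in_set_conv_nth by metis
  then have "x ! (i + k) = a" "x ! (i + l) = c" using ij by auto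
  moreover have "i + k < length x" "i + l < length x" using kl ij by auto
  ultimately show ?thesis
    using occurs_before_nth[of ?w l k] occurs_before_nth[OF x, of "i + l" "i + k"] kl len x by simp
qed

lemma red_interval:
  fixes s :: nat
  assumes "set w = {s+1..s+m}"
  shows "red w = map (\<lambda>v. v - s) w"
  unfolding red_def
proof (rule map_cong[OF refl])
  fix a assume "a \<in> set w"
  then have "{b \<in> set w. b \<le> a} = {s+1..a}" using assms by auto
  then show "card {b \<in> set w. b \<le> a} = a - s" by simp
qed

text \<open>The bounds exclude the value \<open>0\<close>, to which truncated subtraction sends
  every \<open>v \<le> s\<close>.\<close>

lemma occurs_before_shift:
  fixes s :: nat
  assumes "1 \<le> a" "1 \<le> c"
  shows "occurs_before (map (\<lambda>v. v - s) w) c a \<longleftrightarrow> occurs_before w (c + s) (a + s)"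
proof -
  have "v - s = b \<longleftrightarrow> v = b + s" if "1 \<le> b" for v b :: nat using that by auto
  then show ?thesis using assms unfolding occurs_before_def by (auto; metis less_trans nth_map)
qed

text \<open>The values of a half form an interval, so \<open>red\<close> is the shift by
  \<open>s = l - 1\<close>, and \<open>T\<close> itself encodes the reduced word with that
  offset.\<close>

lemma red_half_in_Pop_image_iff:
  assumes x: "x \<in> B_perms n" and TS: "tamari_pair n T S" "encodes_B n x T S"
    and b: "maximal_large_block n x i j" and w: "w = take (j - i) (drop i x)"
    and c: "c \<in> {n+1..2*n}" and set_w: "set w = level n S (S c)" and lv: "level n S (S c) = {l..u}"
  shows "red w \<in> Pop (Tam_A (length w - 1)) ` carrier (Tam_A (length w - 1)) \<longleftrightarrow>
    (\<exists>U. bracket l u U \<and> (\<forall>a\<in>{l..u}. T a = pop_bracket U a))"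
proof -
  have lb: "i < j" "j \<le> length x" using b unfolding maximal_large_block_def large_block_def by auto
  have dw: "distinct w" using B_perms_list(1)[OF x] w by simp
  have lw: "1 \<le> length w" using lb w by simp
  have cl: "c \<in> {l..u}" using c lv[symmetric] by (simp add: level_def)
  have "l \<in> level n S (S c)" using lv cl by simp
  then have l: "n + 1 \<le> l" by (simp add: level_def)
  define s m where "s = l - 1" and "m = length w"
  have "card (set w) = Suc u - l" using set_w lv by simp
  then have "m = Suc u - l" using distinct_card[OF dw] by (simp add: m_def)
  then have sm: "s + 1 = l" "s + m = u" using l cl by (auto simp: s_def)
  have ws: "set w = {s+1..s+m}" using set_w lv sm by simp
  have m1: "1 \<le> m" using lw by (simp add: m_def)
  have TA: "Tam_A (m - 1) = weak_order (avoiders_A m)" "carrier (Tam_A (m - 1)) = avoiders_A m"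
    using m1 by (simp_all add: Tam_A_def avoiders_A_def weak_order_def)
  have B: "bracket (s+1) (s+m) T" using bracket_level[OF TS(1) c lv] sm by simp
  have "encodes_A s m (red w) T"
    unfolding encodes_A_def
  proof (intro allI impI, elim conjE)
    fix a d assume ad: "1 \<le> a" "a < d" "d \<le> m"
    have "occurs_before (red w) d a \<longleftrightarrow> occurs_before w (d + s) (a + s)"
      using occurs_before_shift ad red_interval[OF ws] by simp
    also have "\<dots> \<longleftrightarrow> occurs_before x (d + s) (a + s)"
      unfolding w by (rule occurs_before_sublist[OF B_perms_list(1)[OF x]])
        (use lb ad ws in \<open>auto simp: w[symmetric]\<close>)
    also have "\<dots> \<longleftrightarrow> d + s \<le> T (a + s)"
    proof (rule encodes_BD(1)[OF TS(2)])
      have "d + s \<in> level n S (S c)" using ad ws set_w by auto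
      then show "d + s \<le> 2 * n" by (simp add: level_def)
    qed (use ad l sm in auto)
    finally show "occurs_before (red w) d a \<longleftrightarrow> d + s \<le> T (a + s)" .
  qed
  from Pop_A_image_iff[OF _ B this] show ?thesis
    using red_permutation[OF dw] TA sm by (simp add: m_def)
qed

text \<open>The mirror image of \<open>2 * n\<close> is \<open>1\<close>, in the mirrored position.
  So \<open>S (2 * n) = 2 * n\<close> says that \<open>2 * n\<close> precedes \<open>1\<close>, that
  is, stands among the first \<open>n\<close> positions.\<close>

lemma largest_value_position_iff:
  assumes n: "1 \<le> n" and x: "x \<in> B_perms n" and TS: "tamari_pair n T S" "encodes_B n x T S"
  shows "(\<exists>p. n + 1 \<le> p \<and> p \<le> 2 * n \<and> x ! (p - 1) = 2 * n) \<longleftrightarrow> S (2 * n) < 2 * n"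
proof -
  note xl = B_perms_list[OF x]
  have R: "2 * n \<in> {n+1..2*n}" using n by simp
  have "2 * n \<in> set x" using xl n by simp
  then obtain q where q: "q < 2 * n" "x ! q = 2 * n" using xl(3) in_set_conv_nth by metis
  have "x ! (2 * n - 1 - q) = 1" using B_perms_nth[OF x q(1)] q(2) by simp
  then have "occurs_before x (2 * n) 1 \<longleftrightarrow> q < 2 * n - 1 - q"
    using occurs_before_nth[OF xl(1), of q "2 * n - 1 - q"] q xl(3) by simp
  then have "2 * n \<le> S (2 * n) \<longleftrightarrow> q < n" using encodes_BD(2)[OF TS(2) R R] by auto
  moreover have "(\<exists>p. n + 1 \<le> p \<and> p \<le> 2 * n \<and> x ! (p - 1) = 2 * n) \<longleftrightarrow> n \<le> q"
  proof
    assume "\<exists>p. n + 1 \<le> p \<and> p \<le> 2 * n \<and> x ! (p - 1) = 2 * n"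
    then obtain p where p: "n + 1 \<le> p" "p \<le> 2 * n" "x ! (p - 1) = 2 * n" by blast
    then have "p - 1 = q" using nth_eq_iff_index_eq[OF xl(1), of "p - 1" q] q xl(3) by simp
    then show "n \<le> q" using p by simp
  next
    assume "n \<le> q"
    then show "\<exists>p. n + 1 \<le> p \<and> p \<le> 2 * n \<and> x ! (p - 1) = 2 * n"
      using q by (intro exI[of _ "q + 1"]) simp
  qed
  ultimately show ?thesis by (meson not_le)
qed

theorem mainTheorem18:
  fixes n :: nat and x :: "nat list"
  assumes "1 \<le> n"
    and "x \<in> carrier (Tam_B n)"
  shows "x \<in> Pop (Tam_B n) ` carrier (Tam_B n) \<longleftrightarrow>
    (\<exists>p. n + 1 \<le> p \<and> p \<le> 2 * n \<and> x ! (p - 1) = 2 * n) \<and>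
    (\<forall>k w. is_half n x k w \<longrightarrow>
       red w \<in> Pop (Tam_A (length w - 1)) ` carrier (Tam_A (length w - 1)))"
proof -
  have TB: "Tam_B n = weak_order (avoiders_B n)" "carrier (Tam_B n) = avoiders_B n"
    by (simp_all add: Tam_B_def avoiders_B_def weak_order_def)
  have xA: "x \<in> avoiders_B n" using assms(2) TB by simp
  then have x: "x \<in> B_perms n" by (simp add: avoiders_B_def)
  obtain T S where TS: "tamari_pair n T S" "encodes_B n x T S" using avoiders_B_encoded[OF xA] by blast
  note pos = largest_value_position_iff[OF assms(1) x TS]
  note block_level = maximal_large_block_level[OF x TS]
  have img: "x \<in> Pop (Tam_B n) ` carrier (Tam_B n) \<longleftrightarrow>
    (\<exists>T0 S0. tamari_pair n T0 S0 \<and> (\<forall>a\<in>{n+1..2*n}. T a = pop_bracket T0 a) \<and>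
      (\<forall>d\<in>{n+1..2*n}. S d = pop_shape n T0 S0 d))"
    unfolding TB(2) unfolding TB(1) using Pop_B_image_iff[OF xA TS] .
  show ?thesis
  proof (rule iffI)
    assume "x \<in> Pop (Tam_B n) ` carrier (Tam_B n)"
    then obtain T0 S0 where 0: "tamari_pair n T0 S0" "\<forall>a\<in>{n+1..2*n}. T a = pop_bracket T0 a"
      "\<forall>d\<in>{n+1..2*n}. S d = pop_shape n T0 S0 d" using img by blast
    have "S (2 * n) < 2 * n" using pop_shape_last[OF 0(1) assms(1)] 0(3) assms(1) by simp
    moreover have "red w \<in> Pop (Tam_A (length w - 1)) ` carrier (Tam_A (length w - 1))"
      if h: "is_half n x k w" for k w
    proof -
      obtain i j where b: "maximal_large_block n x i j" and w: "w = take (j - i) (drop i x)"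
        using h unfolding is_half_def by blast
      have lb: "i < j" "j \<le> length x" "n + 1 \<le> x ! i"
        using b unfolding maximal_large_block_def large_block_def by auto
      have c: "x ! i \<in> {n+1..2*n}" using lb nth_mem[of i x] B_perms_list(2)[OF x] by auto
      have sw: "set w = level n S (S (x ! i))" unfolding w using block_level[OF b, of i] lb by simp
      obtain l u where lv: "level n S (S (x ! i)) = {l..u}" using level_interval[OF TS(1) c] by blast
      \<comment> \<open>Popping the shape alone keeps it compatible with the unpopped
        \<open>T0\<close>. Hence \<open>T0\<close> restricts to the levels of \<open>S\<close>, not
        merely to those of \<open>S0\<close>.\<close>
      have "tamari_pair n T0 S"
        by (rule tamari_pair_cong[OF tamari_pair_pop_shape[OF 0(1)]]) (use 0(3) in auto)
      then have "bracket l u T0" using bracket_level[OF _ c lv] by blast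
      moreover have "\<forall>a\<in>{l..u}. T a = pop_bracket T0 a"
        using 0(2) unfolding lv[symmetric] by (simp add: level_def)
      ultimately show ?thesis using red_half_in_Pop_image_iff[OF x TS b w c sw lv] by blast
    qed
    ultimately show "(\<exists>p. n + 1 \<le> p \<and> p \<le> 2 * n \<and> x ! (p - 1) = 2 * n) \<and>
      (\<forall>k w. is_half n x k w \<longrightarrow>
         red w \<in> Pop (Tam_A (length w - 1)) ` carrier (Tam_A (length w - 1)))"
      using pos by blast
  next
    assume R: "(\<exists>p. n + 1 \<le> p \<and> p \<le> 2 * n \<and> x ! (p - 1) = 2 * n) \<and>
      (\<forall>k w. is_half n x k w \<longrightarrow>
         red w \<in> Pop (Tam_A (length w - 1)) ` carrier (Tam_A (length w - 1)))"
    have lev: "\<exists>U. bracket l u U \<and> (\<forall>a\<in>{l..u}. T a = pop_bracket U a)"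
      if c: "c \<in> {n+1..2*n}" and lv: "level n S (S c) = {l..u}" for c l u
    proof -
      \<comment> \<open>Every level arises from a half: the maximal block around any of its
        values.\<close>
      have "c \<in> set x" using c B_perms_list(2)[OF x] by simp
      then obtain p where p: "p < length x" "x ! p = c" using in_set_conv_nth by metis
      then have "n + 1 \<le> x ! p" using c by simp
      from maximal_large_block_exists[OF p(1) this] obtain i j
        where b: "maximal_large_block n x i j" and ij: "i \<le> p" "p < j" by blast
      define w where "w = take (j - i) (drop i x)"
      have "\<exists>k. is_half n x k w" using b unfolding is_half_def w_def by blast
      then have "red w \<in> Pop (Tam_A (length w - 1)) ` carrier (Tam_A (length w - 1))" using R by blast
      moreover have "set w = level n S (S c)" unfolding w_def using block_level[OF b ij] p(2) by simp
      ultimately show ?thesis using red_half_in_Pop_image_iff[OF x TS b w_def c _ lv] by blast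
    qed
    have last: "S (2 * n) < 2 * n" using R pos by blast
    obtain T0 S0 where "tamari_pair n T0 S0"
      "\<And>a. a \<in> {n+1..2*n} \<Longrightarrow> T a = pop_bracket T0 a"
      "\<And>d. d \<in> {n+1..2*n} \<Longrightarrow> S d = pop_shape n T0 S0 d"
      by (rule pop_preimage[OF TS(1) assms(1) last]) (use lev in blast)+
    then show "x \<in> Pop (Tam_B n) ` carrier (Tam_B n)" using img by blast
  qed
qed

end
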